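(* Let $\mathbb{V}=\mathbb{R}_4[X,Y]$ be the 5-dimensional real vector space of homogeneous polynomials of degree $4$ in $X,Y$, with the $\mathrm{PSL}(2,\mathbb{R})$-invariant quadratic form $\mathfrak{q}$ of signature $(2,3)$ given by $\mathfrak{q}(a_4X^4+a_3X^3Y+a_2X^2Y^2+a_1XY^3+a_0Y^4)=2a_4a_0-\frac12 a_1a_3+\frac16 a_2^2$, and let $\mathbb{E}\mathrm{in}^{1,2}=\{[f]\in\mathbb{P}(\mathbb{V}):\mathfrak{q}(f)=0\}$ be the 3-dimensional Einstein universe with its conformal Lorentzian structure. The action of $\mathrm{PSL}(2,\mathbb{R})$ on $\mathbb{E}\mathrm{in}^{1,2}$ induced by its irreducible linear action on $\mathbb{V}$ has exactly three orbits: (i) a $1$-dimensional lightlike orbit, i.e. of signature $(0,0,1)$; (ii) a $2$-dimensional orbit of signature $(0,1,1)$; (iii) an open orbit (hence of signature $(1,2)$) on which the action is free.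
   Context: The group $\mathrm{SL}(2,\mathbb{R})$ acts on $\mathbb{V}=\mathbb{R}_4[X,Y]$ by linear substitution of the variables, $(A\cdot f)(X,Y)=f(A^{-1}(X,Y))$; since the degree is even, $-I$ acts trivially, so this is an action of $\mathrm{PSL}(2,\mathbb{R})$. It is the (unique up to isomorphism) irreducible 5-dimensional representation of $\mathrm{PSL}(2,\mathbb{R})$. It preserves $\mathfrak{q}$, so it acts on $\mathbb{P}(\mathbb{V})$ preserving the projectivized nullcone $\mathbb{E}\mathrm{in}^{1,2}$. Signature $(2,3)$ means that maximal negative definite subspaces have dimension $2$ and maximal positive definite subspaces have dimension $3$. The conformal Lorentzian structure on $\mathbb{E}\mathrm{in}^{1,2}$ is induced by the degenerate metric on the nullcone $\{v\neq 0:\mathfrak{q}(v)=0\}$: for a null vector $f$, the tangent space at $[f]$ is identified (up to the choice of scale of $f$) with $f^{\perp}/\mathbb{R}f$, with the form induced by $\mathfrak{q}$; it has signature $(1,2)$ and is well defined up to a positive factor. An immersed submanifold $S$ of $\mathbb{E}\mathrm{in}^{1,2}$ has signature $(p,q,r)$ if at each point the restriction of this form to the tangent space of $S$ has radical of dimension $r$, and maximal negative definite and positive definite subspaces of dimensions $p$ and $q$ respectively. If $r=0$ one writes $(p,q)$. *)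

theory Defs
  imports "HOL-Analysis.Analysis" "HOL-Algebra.Group_Action"
begin

section \<open>Binary quartics and the invariant quadratic form\<close>

text \<open>
  A quartic $a_4X^4+a_3X^3Y+a_2X^2Y^2+a_1XY^3+a_0Y^4$ is represented by its coefficient
  vector, the coefficient $a_i$ being the component with index \<open>i :: 5\<close> (the elements of the
  type \<open>5\<close> are \<open>0, 1, 2, 3, 4\<close>).
\<close>

type_synonym quartic = "real ^ 5"

definition quartic_eval :: "quartic \<Rightarrow> real ^ 2 \<Rightarrow> real" where
  "quartic_eval a v = (let X = v $ 1; Y = v $ 2 in
     a $ 4 * X ^ 4 + a $ 3 * X ^ 3 * Y + a $ 2 * X ^ 2 * Y ^ 2 + a $ 1 * X * Y ^ 3 + a $ 0 * Y ^ 4)"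

definition qform :: "quartic \<Rightarrow> real" where
  "qform a = 2 * (a $ 4) * (a $ 0) - 1 / 2 * (a $ 1) * (a $ 3) + 1 / 6 * (a $ 2) ^ 2"

text \<open>
  The definite description is justified by \<open>quartic_eval_inject\<close> and \<open>quartic_eval_act\<close> below.
\<close>

definition quartic_act :: "real ^ 2 ^ 2 \<Rightarrow> quartic \<Rightarrow> quartic" where
  "quartic_act A f = (THE g. \<forall>v. quartic_eval g v = quartic_eval f (matrix_inv A *v v))"


section \<open>Signature of a quadratic form on a quotient space\<close>

definition polar_form :: "('v::real_vector \<Rightarrow> real) \<Rightarrow> 'v \<Rightarrow> 'v \<Rightarrow> real" where
  "polar_form Q v w = (Q (v + w) - Q v - Q w) / 2"

text \<open>
  Signature $(p,q,r)$ of the form induced on \<open>W / K\<close> by the quadratic form \<open>Q\<close>, where the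
  subspace \<open>K \<subseteq> W\<close> is contained in the radical of the restriction of \<open>Q\<close> to \<open>W\<close>. Subspaces of
  \<open>W / K\<close> are written as \<open>L / K\<close> with \<open>K \<subseteq> L \<subseteq> W\<close>; such an \<open>L / K\<close> has dimension
  \<open>dim L - dim K\<close>, and a class is nonzero iff its representatives are outside \<open>K\<close>.
\<close>

definition max_quot_dim :: "('v::euclidean_space \<Rightarrow> bool) \<Rightarrow> 'v set \<Rightarrow> 'v set \<Rightarrow> nat \<Rightarrow> bool" where
  "max_quot_dim P W K n \<longleftrightarrow>
     (\<exists>L. subspace L \<and> K \<subseteq> L \<and> L \<subseteq> W \<and> (\<forall>v\<in>L - K. P v) \<and> dim L = dim K + n) \<and>
     (\<forall>L. subspace L \<and> K \<subseteq> L \<and> L \<subseteq> W \<and> (\<forall>v\<in>L - K. P v) \<longrightarrow> dim L \<le> dim K + n)"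

definition quot_signature ::
  "('v::euclidean_space \<Rightarrow> real) \<Rightarrow> 'v set \<Rightarrow> 'v set \<Rightarrow> nat \<times> nat \<times> nat \<Rightarrow> bool" where
  "quot_signature Q W K = (\<lambda>(p, q, r).
     max_quot_dim (\<lambda>v. Q v < 0) W K p \<and>
     max_quot_dim (\<lambda>v. Q v > 0) W K q \<and>
     dim {v \<in> W. \<forall>w\<in>W. polar_form Q v w = 0} = dim K + r)"


section \<open>Projective space and the Einstein universe\<close>

definition proj_point :: "quartic \<Rightarrow> quartic set" where
  "proj_point f = span {f}"

definition proj_space :: "quartic set set" where
  "proj_space = proj_point ` (- {0})"

text \<open>The quotient topology of \<open>- {0}\<close>.\<close>

definition proj_topology :: "quartic set topology" where
  "proj_topology = topology (\<lambda>U. U \<subseteq> proj_space \<and> open {f. f \<noteq> 0 \<and> proj_point f \<in> U})"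

definition Ein :: "quartic set set" where
  "Ein = {proj_point f |f. f \<noteq> 0 \<and> qform f = 0}"

definition Ein_topology :: "quartic set topology" where
  "Ein_topology = subtopology proj_topology Ein"


section \<open>Immersed submanifolds of the Einstein universe and their signature\<close>

text \<open>\<open>k\<close> times continuously differentiable on an open set \<open>S\<close>.\<close>

primrec Ck_on :: "nat \<Rightarrow> 'a::euclidean_space set \<Rightarrow> ('a \<Rightarrow> 'b::euclidean_space) \<Rightarrow> bool" where
  "Ck_on 0 S f \<longleftrightarrow> continuous_on S f"
| "Ck_on (Suc k) S f \<longleftrightarrow>
     (\<forall>x\<in>S. f differentiable (at x)) \<and> (\<forall>v. Ck_on k S (\<lambda>x. frechet_derivative f (at x) v))"

definition smooth_on :: "'a::euclidean_space set \<Rightarrow> ('a \<Rightarrow> 'b::euclidean_space) \<Rightarrow> bool" where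
  "smooth_on S f \<longleftrightarrow> (\<forall>k. Ck_on k S f)"

text \<open>
  Smooth maps into projective space are described by smooth lifts to the nonzero vectors (locally
  these always exist). The tangent space of projective space at $[f]$ is the quotient of the space
  of quartics by $\mathbb{R}f$ (up to the choice of scale of $f$), so
  $u \mapsto [\varphi(u)]$ is an immersion at $u$ iff no nonzero tangent vector is mapped into
  $\mathbb{R}\varphi(u)$ by the derivative of $\varphi$.
\<close>

definition Ein_immersion :: "'m::euclidean_space set \<Rightarrow> ('m \<Rightarrow> quartic) \<Rightarrow> bool" where
  "Ein_immersion U \<phi> \<longleftrightarrow> open U \<and> smooth_on U \<phi> \<and>
     (\<forall>u\<in>U. \<phi> u \<noteq> 0 \<and> qform (\<phi> u) = 0 \<and>
        (\<forall>w. frechet_derivative \<phi> (at u) w \<in> span {\<phi> u} \<longrightarrow> w = 0))"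

text \<open>
  A local parametrization of the set underlying \<open>T\<close>: the topology \<open>T\<close> is the manifold topology,
  which may be finer than the subspace topology.
\<close>

definition local_param ::
  "quartic set topology \<Rightarrow> 'm::euclidean_space set \<Rightarrow> ('m \<Rightarrow> quartic) \<Rightarrow> bool" where
  "local_param T U \<phi> \<longleftrightarrow> Ein_immersion U \<phi> \<and> openin T ((proj_point \<circ> \<phi>) ` U) \<and>
     homeomorphic_map (top_of_set U) (subtopology T ((proj_point \<circ> \<phi>) ` U)) (proj_point \<circ> \<phi>)"

text \<open>
  The subspace of $\varphi(u)^\perp$, containing $\mathbb{R}\varphi(u)$, whose quotient by
  $\mathbb{R}\varphi(u)$ is the tangent space at $[\varphi(u)]$ of the parametrized submanifold.
\<close>

definition lifted_tangent_space :: "('m::euclidean_space \<Rightarrow> quartic) \<Rightarrow> 'm \<Rightarrow> quartic set" where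
  "lifted_tangent_space \<phi> u = {c *\<^sub>R \<phi> u + frechet_derivative \<phi> (at u) w |c w. True}"

text \<open>
  \<open>S\<close> is an immersed submanifold, of the dimension of the model space \<open>'m\<close>, having signature
  \<open>sig\<close> at each of its points. Changes of parametrization are homeomorphisms by the choice of \<open>T\<close>,
  and they are automatically smooth because the parametrizations are immersions; therefore the
  tangent spaces, and the signature, do not depend on the parametrization chosen at a point. The
  manifold topology \<open>T\<close> is Hausdorff because it is finer than the one induced by \<open>Ein_topology\<close>.
\<close>

definition immersed_submanifold_with_signature ::
  "'m::euclidean_space itself \<Rightarrow> quartic set set \<Rightarrow> nat \<times> nat \<times> nat \<Rightarrow> bool" where
  "immersed_submanifold_with_signature _ S sig \<longleftrightarrow> S \<subseteq> Ein \<and>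
     (\<exists>T. topspace T = S \<and> second_countable T \<and> continuous_map T Ein_topology id \<and>
        (\<forall>p\<in>S. \<exists>(U :: 'm set) \<phi> u. local_param T U \<phi> \<and> u \<in> U \<and> p = proj_point (\<phi> u) \<and>
           quot_signature qform (lifted_tangent_space \<phi> u) (span {\<phi> u}) sig))"


section \<open>The group PSL(2,R) and its action\<close>

definition SL2 :: "(real ^ 2 ^ 2) monoid" where
  "SL2 = \<lparr>carrier = {A. det A = 1}, mult = (**), one = mat 1\<rparr>"

definition PSL2 :: "(real ^ 2 ^ 2) set monoid" where
  "PSL2 = SL2 Mod {mat 1, - mat 1}"

text \<open>
  The action of a class \<open>{A, - A}\<close> on \<open>Ein\<close>, extended by \<open>undefined\<close> as the library's
  \<open>group_action\<close> requires. It does not depend on the representative, see \<open>PSL2_act_rcos\<close>.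
\<close>

definition PSL2_act :: "(real ^ 2 ^ 2) set \<Rightarrow> quartic set \<Rightarrow> quartic set" where
  "PSL2_act C = (\<lambda>L\<in>Ein. quartic_act (SOME A. A \<in> C) ` L)"


section \<open>Well-definedness\<close>

lemma UNIV_5: "(UNIV :: 5 set) = {0, 1, 2, 3, 4}"
proof -
  have "card {0, 1, 2, 3, 4 :: 5} = CARD(5)"
    by simp
  then show ?thesis
    by (metis card_subset_eq finite subset_UNIV)
qed

lemma forall_5: "(\<forall>i::5. P i) \<longleftrightarrow> P 0 \<and> P 1 \<and> P 2 \<and> P 3 \<and> P 4"
  by (metis UNIV_5 UNIV_I empty_iff insert_iff)

lemma quartic_eq_iff:
  "(f :: quartic) = g \<longleftrightarrow> f $ 0 = g $ 0 \<and> f $ 1 = g $ 1 \<and> f $ 2 = g $ 2 \<and> f $ 3 = g $ 3 \<and> f $ 4 = g $ 4"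
  by (simp add: vec_eq_iff forall_5)

definition mk_quartic :: "real \<Rightarrow> real \<Rightarrow> real \<Rightarrow> real \<Rightarrow> real \<Rightarrow> quartic" where
  "mk_quartic e d c b a =
     (\<chi> i. if i = 4 then e else if i = 3 then d else if i = 2 then c else if i = 1 then b else a)"

lemma mk_quartic_nth [simp]:
  "mk_quartic e d c b a $ 0 = a" "mk_quartic e d c b a $ 1 = b" "mk_quartic e d c b a $ 2 = c"
  "mk_quartic e d c b a $ 3 = d" "mk_quartic e d c b a $ 4 = e"
  by (simp_all add: mk_quartic_def)

lemma quartic_eval_inject:
  assumes "\<forall>v. quartic_eval f v = quartic_eval g v"
  shows "f = g"
proof -
  have "quartic_eval f (vector [x, y]) = quartic_eval g (vector [x, y])" for x y
    using assms by blast
  from this[of 1 0] this[of 0 1] this[of 1 1] this[of 1 "-1"] this[of 1 2] show ?thesis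
    by (simp add: quartic_eval_def quartic_eq_iff)
qed

definition subst_quartic :: "real ^ 2 ^ 2 \<Rightarrow> quartic \<Rightarrow> quartic" where
  "subst_quartic M f = (let p = M $ 1 $ 1; q = M $ 1 $ 2; r = M $ 2 $ 1; s = M $ 2 $ 2 in
     mk_quartic
      (f$4 * p^4 + f$3 * p^3 * r + f$2 * p^2 * r^2 + f$1 * p * r^3 + f$0 * r^4)
      (f$4 * (4 * p^3 * q) + f$3 * (p^3 * s + 3 * p^2 * q * r) + f$2 * (2 * p^2 * r * s + 2 * p * q * r^2)
        + f$1 * (3 * p * r^2 * s + q * r^3) + f$0 * (4 * r^3 * s))
      (f$4 * (6 * p^2 * q^2) + f$3 * (3 * p^2 * q * s + 3 * p * q^2 * r)
        + f$2 * (p^2 * s^2 + 4 * p * q * r * s + q^2 * r^2)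
        + f$1 * (3 * p * r * s^2 + 3 * q * r^2 * s) + f$0 * (6 * r^2 * s^2))
      (f$4 * (4 * p * q^3) + f$3 * (3 * p * q^2 * s + q^3 * r) + f$2 * (2 * p * q * s^2 + 2 * q^2 * r * s)
        + f$1 * (p * s^3 + 3 * q * r * s^2) + f$0 * (4 * r * s^3))
      (f$4 * q^4 + f$3 * q^3 * s + f$2 * q^2 * s^2 + f$1 * q * s^3 + f$0 * s^4))"

lemma quartic_eval_subst: "quartic_eval (subst_quartic M f) v = quartic_eval f (M *v v)"
  by (simp add: quartic_eval_def subst_quartic_def Let_def matrix_vector_mult_def sum_2) algebra

lemma quartic_act_eq_subst: "quartic_act A f = subst_quartic (matrix_inv A) f"
  unfolding quartic_act_def
  by (rule the_equality) (auto simp: quartic_eval_subst intro!: quartic_eval_inject)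

lemma quartic_eval_act: "quartic_eval (quartic_act A f) v = quartic_eval f (matrix_inv A *v v)"
  by (simp add: quartic_act_eq_subst quartic_eval_subst)

lemma linear_quartic_act: "linear (quartic_act A)"
  by (rule linearI)
    (auto simp: quartic_act_eq_subst subst_quartic_def Let_def quartic_eq_iff algebra_simps)

lemma matrix_inv_inverse:
  assumes "invertible A"
  shows "A ** matrix_inv A = mat 1" "matrix_inv A ** A = mat 1"
  using someI_ex[OF assms[unfolded invertible_def]] unfolding matrix_inv_def by auto

lemma matrix_inv_eqI:
  fixes A B :: "real ^ 'n ^ 'n"
  assumes "A ** B = mat 1"
  shows "matrix_inv A = B"
proof -
  have "B ** A = mat 1"
    using assms matrix_left_right_inverse by blast
  then have "invertible A"
    using assms unfolding invertible_def by blast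
  then have "matrix_inv A ** A = mat 1"
    by (rule matrix_inv_inverse)
  then show ?thesis
    by (metis assms matrix_mul_assoc matrix_mul_lid matrix_mul_rid)
qed

lemma SL2_matrix_inv:
  fixes A :: "real ^ 2 ^ 2"
  assumes "det A = 1"
  shows "A ** matrix_inv A = mat 1" "matrix_inv A ** A = mat 1" "det (matrix_inv A) = 1"
proof -
  have "invertible A"
    using assms by (simp add: invertible_det_nz)
  then show *: "A ** matrix_inv A = mat 1" "matrix_inv A ** A = mat 1"
    by (simp_all add: matrix_inv_inverse)
  show "det (matrix_inv A) = 1"
    using * assms by (metis det_I det_mul mult_1)
qed

lemma mat_uminus_mult:
  fixes A B :: "real ^ 2 ^ 2"
  shows "(- A) ** B = - (A ** B)" "A ** (- B) = - (A ** B)" "(- A) *v v = - (A *v v)"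
  by (simp_all add: vec_eq_iff matrix_matrix_mult_def matrix_vector_mult_def sum_negf)

lemma det_uminus_2: "det (- A) = det (A :: real ^ 2 ^ 2)"
  by (simp add: det_2)

lemma quartic_eval_uminus: "quartic_eval f (- v) = quartic_eval f v"
  by (simp add: quartic_eval_def Let_def power3_eq_cube)

lemma quartic_act_uminus:
  assumes "det A = 1"
  shows "quartic_act (- A) f = quartic_act A f"
proof (rule quartic_eval_inject, rule allI)
  fix v
  have "matrix_inv (- A) = - matrix_inv A"
    using SL2_matrix_inv[OF assms] by (intro matrix_inv_eqI) (simp add: mat_uminus_mult)
  then show "quartic_eval (quartic_act (- A) f) v = quartic_eval (quartic_act A f) v"
    by (simp add: quartic_eval_act mat_uminus_mult quartic_eval_uminus)
qed

lemma quartic_act_mult: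
  assumes "det A = 1" "det B = 1"
  shows "quartic_act (A ** B) f = quartic_act A (quartic_act B f)"
proof (rule quartic_eval_inject, rule allI)
  fix v
  have "(A ** B) ** (matrix_inv B ** matrix_inv A) = A ** (B ** matrix_inv B) ** matrix_inv A"
    by (simp add: matrix_mul_assoc)
  also have "\<dots> = mat 1"
    using assms by (simp add: SL2_matrix_inv)
  finally have "matrix_inv (A ** B) = matrix_inv B ** matrix_inv A"
    by (rule matrix_inv_eqI)
  then show "quartic_eval (quartic_act (A ** B) f) v = quartic_eval (quartic_act A (quartic_act B f)) v"
    by (simp add: quartic_eval_act matrix_vector_mul_assoc)
qed

lemma quartic_act_one [simp]: "quartic_act (mat 1) f = f"
proof (rule quartic_eval_inject, rule allI)
  fix v
  have "matrix_inv (mat 1 :: real ^ 2 ^ 2) = mat 1"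
    by (rule matrix_inv_eqI) simp
  then show "quartic_eval (quartic_act (mat 1) f) v = quartic_eval f v"
    by (simp add: quartic_eval_act)
qed

lemma qform_subst: "qform (subst_quartic M f) = det M ^ 4 * qform f"
  unfolding qform_def subst_quartic_def Let_def det_2 mk_quartic_nth
  by (simp add: field_simps) algebra

lemma qform_act:
  assumes "det A = 1"
  shows "qform (quartic_act A f) = qform f"
  using SL2_matrix_inv(3)[OF assms] by (simp add: quartic_act_eq_subst qform_subst)

lemma qform_signature: "quot_signature qform UNIV {0} (2, 3, 0)"
proof -
  define N :: "quartic set" where "N = range (\<lambda>x :: real ^ 2. mk_quartic (x $ 1) (x $ 2) 0 (x $ 2) (- (x $ 1)))"
  define P :: "quartic set" where
    "P = range (\<lambda>x :: real ^ 3. mk_quartic (x $ 1) (x $ 2) (x $ 3) (- (x $ 2)) (x $ 1))"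
  have lin2: "linear (\<lambda>x :: real ^ 2. mk_quartic (x $ 1) (x $ 2) 0 (x $ 2) (- (x $ 1)))"
    by (rule linearI) (auto simp: quartic_eq_iff)
  have lin3: "linear (\<lambda>x :: real ^ 3. mk_quartic (x $ 1) (x $ 2) (x $ 3) (- (x $ 2)) (x $ 1))"
    by (rule linearI) (auto simp: quartic_eq_iff)
  have N: "subspace N" "dim N = 2"
    unfolding N_def using lin2
    by (auto intro!: linear_subspace_image simp: dim_image_eq inj_on_def quartic_eq_iff vec_eq_iff forall_2)
  have P: "subspace P" "dim P = 3"
    unfolding P_def using lin3
    by (auto intro!: linear_subspace_image simp: dim_image_eq inj_on_def quartic_eq_iff vec_eq_iff forall_3)
  have Nneg: "qform v < 0" if "v \<in> N - {0}" for v
  proof -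
    obtain x :: "real ^ 2" where x: "v = mk_quartic (x $ 1) (x $ 2) 0 (x $ 2) (- (x $ 1))"
      using \<open>v \<in> N - {0}\<close> unfolding N_def by blast
    have q: "qform v = - (2 * (x $ 1)\<^sup>2 + 1 / 2 * (x $ 2)\<^sup>2)"
      by (simp add: x qform_def power2_eq_square)
    have "x $ 1 \<noteq> 0 \<or> x $ 2 \<noteq> 0"
      using that x by (auto simp: quartic_eq_iff)
    then have "(x $ 1)\<^sup>2 > 0 \<or> (x $ 2)\<^sup>2 > 0"
      by simp
    then show ?thesis
      unfolding q using zero_le_power2[of "x $ 1"] zero_le_power2[of "x $ 2"] by linarith
  qed
  have Ppos: "qform v > 0" if "v \<in> P - {0}" for v
  proof -
    obtain x :: "real ^ 3" where x: "v = mk_quartic (x $ 1) (x $ 2) (x $ 3) (- (x $ 2)) (x $ 1)"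
      using \<open>v \<in> P - {0}\<close> unfolding P_def by blast
    have q: "qform v = 2 * (x $ 1)\<^sup>2 + 1 / 2 * (x $ 2)\<^sup>2 + 1 / 6 * (x $ 3)\<^sup>2"
      by (simp add: x qform_def power2_eq_square)
    have "x $ 1 \<noteq> 0 \<or> x $ 2 \<noteq> 0 \<or> x $ 3 \<noteq> 0"
      using that x by (auto simp: quartic_eq_iff)
    then show ?thesis
      unfolding q by (auto simp: add_pos_nonneg add_nonneg_pos)
  qed
  have bound: "dim L + dim M \<le> 5"
    if "subspace L" "subspace M" "\<And>v. v \<in> L \<Longrightarrow> v \<in> M \<Longrightarrow> v = 0" for L M :: "quartic set"
  proof -
    have "L \<inter> M \<subseteq> {0}"
      using that by blast
    then have "dim (L \<inter> M) = 0"
      by simp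
    moreover have "dim {x + y |x y. x \<in> L \<and> y \<in> M} \<le> 5"
      using dim_subset_UNIV[of "{x + y |x y. x \<in> L \<and> y \<in> M}"] by simp
    ultimately show ?thesis
      using dim_sums_Int[OF that(1,2)] by linarith
  qed
  have "max_quot_dim (\<lambda>v. qform v < 0) UNIV {0} 2"
    unfolding max_quot_dim_def
  proof (intro conjI exI allI impI)
    fix L :: "quartic set"
    assume L: "subspace L \<and> {0} \<subseteq> L \<and> L \<subseteq> UNIV \<and> (\<forall>v\<in>L - {0}. qform v < 0)"
    have "v = 0" if "v \<in> L" "v \<in> P" for v
      using L Ppos that by (metis DiffI empty_iff insert_iff order_less_asym)
    then show "dim L \<le> dim {0 :: quartic} + 2"
      using bound[of L P] P L by simp
  qed (use N Nneg in \<open>auto simp: subspace_0\<close>)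
  moreover have "max_quot_dim (\<lambda>v. qform v > 0) UNIV {0} 3"
    unfolding max_quot_dim_def
  proof (intro conjI exI allI impI)
    fix L :: "quartic set"
    assume L: "subspace L \<and> {0} \<subseteq> L \<and> L \<subseteq> UNIV \<and> (\<forall>v\<in>L - {0}. qform v > 0)"
    have "v = 0" if "v \<in> L" "v \<in> N" for v
      using L Nneg that by (metis DiffI empty_iff insert_iff order_less_asym)
    then show "dim L \<le> dim {0 :: quartic} + 3"
      using bound[of L N] N L by simp
  qed (use P Ppos in \<open>auto simp: subspace_0\<close>)
  moreover have "v = 0" if v: "\<forall>w. polar_form qform v w = 0" for v
    using spec[OF v, of "mk_quartic 1 0 0 0 0"] spec[OF v, of "mk_quartic 0 1 0 0 0"]
      spec[OF v, of "mk_quartic 0 0 1 0 0"] spec[OF v, of "mk_quartic 0 0 0 1 0"]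
      spec[OF v, of "mk_quartic 0 0 0 0 1"]
    by (simp add: quartic_eq_iff polar_form_def qform_def power2_eq_square algebra_simps)
  then have "{v \<in> UNIV. \<forall>w\<in>UNIV. polar_form qform v w = 0} \<subseteq> {0}"
    by auto
  then have "dim {v \<in> UNIV. \<forall>w\<in>UNIV. polar_form qform v w = 0} = 0"
    by simp
  ultimately show ?thesis
    by (simp add: quot_signature_def)
qed

lemma openin_proj_topology:
  "openin proj_topology U \<longleftrightarrow> U \<subseteq> proj_space \<and> open {f. f \<noteq> 0 \<and> proj_point f \<in> U}"
proof -
  have "istopology (\<lambda>U. U \<subseteq> proj_space \<and> open {f. f \<noteq> 0 \<and> proj_point f \<in> U})"
    unfolding istopology_def
  proof (intro conjI allI impI)
    fix S T
    assume "S \<subseteq> proj_space \<and> open {f. f \<noteq> 0 \<and> proj_point f \<in> S}"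
      "T \<subseteq> proj_space \<and> open {f. f \<noteq> 0 \<and> proj_point f \<in> T}"
    then have "open ({f. f \<noteq> 0 \<and> proj_point f \<in> S} \<inter> {f. f \<noteq> 0 \<and> proj_point f \<in> T})"
      by blast
    moreover have "{f. f \<noteq> 0 \<and> proj_point f \<in> S} \<inter> {f. f \<noteq> 0 \<and> proj_point f \<in> T} =
        {f. f \<noteq> 0 \<and> proj_point f \<in> S \<inter> T}"
      by blast
    ultimately show "open {f. f \<noteq> 0 \<and> proj_point f \<in> S \<inter> T}"
      by simp
  next
    fix \<K>
    assume "\<forall>K\<in>\<K>. K \<subseteq> proj_space \<and> open {f. f \<noteq> 0 \<and> proj_point f \<in> K}"
    then have "open (\<Union>K\<in>\<K>. {f. f \<noteq> 0 \<and> proj_point f \<in> K})"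
      by blast
    moreover have "(\<Union>K\<in>\<K>. {f. f \<noteq> 0 \<and> proj_point f \<in> K}) = {f. f \<noteq> 0 \<and> proj_point f \<in> \<Union>\<K>}"
      by blast
    ultimately show "open {f. f \<noteq> 0 \<and> proj_point f \<in> \<Union>\<K>}"
      by simp
  qed auto
  then show ?thesis
    by (simp add: proj_topology_def)
qed

lemma quartic_act_proj_point: "quartic_act A ` proj_point f = proj_point (quartic_act A f)"
  unfolding proj_point_def by (simp add: linear_span_image[OF linear_quartic_act, symmetric])

lemma quartic_act_inverse:
  assumes "det A = 1"
  shows "quartic_act (matrix_inv A) (quartic_act A f) = f"
  using assms by (simp add: quartic_act_mult[symmetric] SL2_matrix_inv)

lemma quartic_act_Ein:
  assumes "det A = 1" "L \<in> Ein"
  shows "quartic_act A ` L \<in> Ein"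
proof -
  obtain f where f: "L = proj_point f" "f \<noteq> 0" "qform f = 0"
    using assms by (auto simp: Ein_def)
  have "quartic_act A f \<noteq> 0"
    using f quartic_act_inverse[OF assms(1), of f] linear_0[OF linear_quartic_act] by metis
  then show ?thesis
    using f qform_act[OF assms(1)] unfolding Ein_def quartic_act_proj_point f(1) by auto
qed

lemma group_SL2: "group SL2"
proof (rule groupI)
  fix A assume "A \<in> carrier SL2"
  then show "\<exists>B\<in>carrier SL2. B \<otimes>\<^bsub>SL2\<^esub> A = \<one>\<^bsub>SL2\<^esub>"
    using SL2_matrix_inv[of A] by (auto simp: SL2_def)
qed (auto simp: SL2_def det_mul matrix_mul_assoc)

lemma SL2_simps [simp]:
  "A \<in> carrier SL2 \<longleftrightarrow> det A = 1" "A \<otimes>\<^bsub>SL2\<^esub> B = A ** B" "\<one>\<^bsub>SL2\<^esub> = mat 1"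
  by (simp_all add: SL2_def)

lemma rcos_center: "{mat 1, - mat 1} #>\<^bsub>SL2\<^esub> A = {A, - A}"
  by (auto simp: r_coset_def mat_uminus_mult)

lemma normal_center: "{mat 1, - mat 1} \<lhd> SL2"
proof -
  interpret group SL2 by (rule group_SL2)
  have "inv\<^bsub>SL2\<^esub> (- mat 1) = - mat 1"
    by (rule inv_equality) (auto simp: mat_uminus_mult det_uminus_2)
  then have "subgroup {mat 1, - mat 1} SL2"
    using inv_one by (intro subgroupI) (auto simp: det_uminus_2 mat_uminus_mult)
  moreover have "{mat 1, - mat 1} #>\<^bsub>SL2\<^esub> A = A <#\<^bsub>SL2\<^esub> {mat 1, - mat 1}" for A
    unfolding rcos_center by (auto simp: l_coset_def mat_uminus_mult)
  ultimately show ?thesis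
    by (intro normalI) auto
qed

lemma carrier_PSL2: "carrier PSL2 = {{A, - A} |A. det A = 1}"
  by (auto simp: PSL2_def carrier_FactGroup rcos_center)

lemma PSL2_act_rcos:
  assumes "det A = 1" "L \<in> Ein"
  shows "PSL2_act {A, - A} L = quartic_act A ` L"
proof -
  have "(SOME B. B \<in> {A, - A}) \<in> {A, - A}"
    by (rule someI[of _ A]) simp
  then show ?thesis
    using assms quartic_act_uminus[OF assms(1)] by (auto simp: PSL2_act_def)
qed

lemma PSL2_mult:
  assumes "det A = 1" "det B = 1"
  shows "{A, - A} \<otimes>\<^bsub>PSL2\<^esub> {B, - B} = {A ** B, - (A ** B)}"
  by (auto simp: PSL2_def set_mult_def mat_uminus_mult)

lemma PSL2_group_action: "group_action PSL2 Ein PSL2_act"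
proof -
  have act_act: "quartic_act A ` quartic_act B ` L = quartic_act (A ** B) ` L"
    if "det A = 1" "det B = 1" for A B L
    using that by (simp add: image_image quartic_act_mult)
  have bij: "PSL2_act {A, - A} \<in> Bij Ein" if A: "det A = 1" for A
  proof -
    have "bij_betw (\<lambda>L. quartic_act A ` L) Ein Ein"
      by (rule bij_betw_byWitness[where f' = "\<lambda>L. quartic_act (matrix_inv A) ` L"])
        (use A in \<open>auto simp: act_act SL2_matrix_inv quartic_act_Ein\<close>)
    then have "bij_betw (PSL2_act {A, - A}) Ein Ein"
      using A by (simp add: PSL2_act_rcos cong: bij_betw_cong)
    then show ?thesis
      by (simp add: Bij_def PSL2_act_def)
  qed
  have "PSL2_act ({A, - A} \<otimes>\<^bsub>PSL2\<^esub> {B, - B}) = compose Ein (PSL2_act {A, - A}) (PSL2_act {B, - B})"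
    if "det A = 1" "det B = 1" for A B
  proof (rule extensionalityI[of _ Ein])
    fix L assume "L \<in> Ein"
    then show "PSL2_act ({A, - A} \<otimes>\<^bsub>PSL2\<^esub> {B, - B}) L =
        compose Ein (PSL2_act {A, - A}) (PSL2_act {B, - B}) L"
      using that by (simp add: PSL2_mult compose_eq PSL2_act_rcos det_mul quartic_act_Ein act_act)
  qed (auto simp: PSL2_act_def)
  then have "PSL2_act \<in> hom PSL2 (BijGroup Ein)"
    using bij by (auto simp: hom_def carrier_PSL2 BijGroup_def)
  moreover have "group PSL2"
    unfolding PSL2_def by (rule normal.factorgroup_is_group[OF normal_center])
  ultimately show ?thesis
    by (simp add: group_action_def group_hom_def group_hom_axioms_def group_BijGroup)
qed

end

(* A null quartic is classified by its multiple roots: the catalecticant of a null quartic vanishes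
   exactly when there is a root of multiplicity at least three, and otherwise two roots are real,
   two are complex conjugate, and their cross ratio is equianharmonic. The orbits are those of X^4,
   of X^3 Y and of X (X^3 + Y^3). A complex projective map permuting the roots of the last quartic
   up to scale and commuting with conjugation is trivial or the involution exchanging the roots in
   both pairs; that involution reverses the orientation, so it makes PGL(2,R)-equivalent quartics
   PSL(2,R)-equivalent and is absent from the stabilizers.
   Each orbit carries the subspace topology and is parametrized in the affine chart a_4 = 1 by
   polynomials. By homogeneity one such chart is enough, and the signature need only be computed at
   one point. *)

theory Submission
  imports Defs
begin

section \<open>Positive linear substitutions and the orbits\<close>

text \<open>Up to scale, \<open>qform\<close> and \<open>catalecticant\<close> are the classical
  generators I and J, of degrees 2 and 3, of the invariants of binary quartics; \<open>qform\<close>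
  is 2 I. The discriminant is a positive multiple of I^3 - 27 J^2, hence on the nullcone a negative
  multiple of J^2. This is why one further invariant isolates the quartics with simple roots, and
  why exactly two of these roots are real. The discriminant itself is never formed: null quartics
  are normalized by real shears, and each shear that kills one coefficient lets the equation
  \<open>qform f = 0\<close> determine a second one. Polynomial charts are convenient because
  directional derivatives of polynomial maps are polynomial, so that smoothness of every order
  follows by one induction.\<close>

definition mat2 :: "real \<Rightarrow> real \<Rightarrow> real \<Rightarrow> real \<Rightarrow> real ^ 2 ^ 2" where
  "mat2 p q r s = vector [vector [p, q], vector [r, s]]"

lemma mat2_nth [simp]:
  "mat2 p q r s $ 1 $ 1 = p" "mat2 p q r s $ 1 $ 2 = q"
  "mat2 p q r s $ 2 $ 1 = r" "mat2 p q r s $ 2 $ 2 = s"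
  by (simp_all add: mat2_def)

lemma det_mat2 [simp]: "det (mat2 p q r s) = p * s - q * r"
  by (simp add: det_2)

section \<open>Substitution as a right action, and its homogeneity\<close>

lemma subst_quartic_mult: "subst_quartic M (subst_quartic N f) = subst_quartic (N ** M) f"
  by (rule quartic_eval_inject) (simp add: quartic_eval_subst matrix_vector_mul_assoc)

lemma subst_quartic_one [simp]: "subst_quartic (mat 1) f = f"
  by (rule quartic_eval_inject) (simp add: quartic_eval_subst)

lemma quartic_eval_scaleR: "quartic_eval (c *\<^sub>R f) v = c * quartic_eval f v"
  by (simp add: quartic_eval_def Let_def algebra_simps)

lemma quartic_eval_scaleR_arg: "quartic_eval f (c *\<^sub>R v) = c ^ 4 * quartic_eval f v"
  by (simp add: quartic_eval_def Let_def power_mult_distrib) algebra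

lemma subst_quartic_scaleR: "subst_quartic M (c *\<^sub>R f) = c *\<^sub>R subst_quartic M f"
  by (rule quartic_eval_inject) (simp add: quartic_eval_subst quartic_eval_scaleR)

lemma subst_quartic_scaleR_matrix: "subst_quartic (c *\<^sub>R M) f = c ^ 4 *\<^sub>R subst_quartic M f"
  by (rule quartic_eval_inject)
    (simp add: quartic_eval_subst quartic_eval_scaleR quartic_eval_scaleR_arg scaleR_matrix_vector_assoc[symmetric])

lemma qform_scaleR: "qform (c *\<^sub>R f) = c\<^sup>2 * qform f"
  by (simp add: qform_def power2_eq_square algebra_simps)

lemma pos_det_inverse:
  fixes M :: "real ^ 2 ^ 2"
  assumes "det M > 0"
  obtains N where "det N > 0" "N ** M = mat 1" "M ** N = mat 1"
proof -
  have "invertible M"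
    using assms by (simp add: invertible_det_nz)
  then obtain N where N: "N ** M = mat 1" "M ** N = mat 1"
    unfolding invertible_def by blast
  then have "det N * det M = 1"
    by (metis det_I det_mul)
  then have "det N > 0"
    using assms by (metis zero_less_mult_pos2 zero_less_one)
  then show thesis
    using that N by blast
qed

lemma subst_quartic_0 [simp]: "subst_quartic M 0 = 0"
  using subst_quartic_scaleR[of M 0] by simp

lemma subst_quartic_eq_0_iff:
  assumes "det M > 0"
  shows "subst_quartic M f = 0 \<longleftrightarrow> f = 0"
proof -
  obtain N where "M ** N = mat 1"
    using pos_det_inverse[OF assms] by blast
  then have "subst_quartic N (subst_quartic M f) = f"
    by (simp add: subst_quartic_mult)
  then show ?thesis
    by (metis subst_quartic_0)
qed

section \<open>Representatives of projective points, and membership in orbits\<close>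

lemma proj_point_eqD:
  assumes "proj_point f = proj_point g" "f \<noteq> 0"
  obtains c where "c \<noteq> 0" "f = c *\<^sub>R g"
proof -
  have "f \<in> span {g}"
    using assms(1) span_base[of f "{f}"] by (simp add: proj_point_def)
  then obtain c where "f = c *\<^sub>R g"
    by (auto simp: span_singleton)
  then show thesis
    using that assms(2) by auto
qed

lemma proj_point_scaleR:
  assumes "c \<noteq> 0"
  shows "proj_point (c *\<^sub>R f) = proj_point f"
  using span_image_scale[of "{f}" "\<lambda>_. c"] assms by (simp add: proj_point_def)

lemma proj_point_in_Ein:
  assumes "f \<noteq> 0"
  shows "proj_point f \<in> Ein \<longleftrightarrow> qform f = 0"
proof
  assume "proj_point f \<in> Ein"
  then obtain g where "proj_point f = proj_point g" "qform g = 0"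
    by (auto simp: Ein_def)
  then show "qform f = 0"
    using assms by (metis mult_zero_right proj_point_eqD qform_scaleR)
qed (use assms in \<open>auto simp: Ein_def\<close>)

lemma subst_quartic_Ein:
  assumes "det M > 0" "f \<noteq> 0" "qform f = 0"
  shows "proj_point (subst_quartic M f) \<in> Ein"
  using assms by (simp add: proj_point_in_Ein subst_quartic_eq_0_iff qform_subst)

definition proj_orbit :: "quartic \<Rightarrow> quartic set set" where
  "proj_orbit f = {proj_point (subst_quartic M f) |M. det M > 0}"

text \<open>Positive determinants suffice, since homotheties act trivially on the projective space.\<close>

lemma proj_orbit_SL2: "proj_orbit f = {proj_point (quartic_act A f) |A. det A = 1}"
proof (intro equalityI subsetI)
  fix p assume "p \<in> {proj_point (quartic_act A f) |A. det A = 1}"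
  then obtain A where "det A = 1" "p = proj_point (quartic_act A f)"
    by blast
  then show "p \<in> proj_orbit f"
    unfolding proj_orbit_def quartic_act_eq_subst
    using SL2_matrix_inv(3) by (metis (mono_tags, lifting) mem_Collect_eq zero_less_one)
next
  fix p assume "p \<in> proj_orbit f"
  then obtain M where M: "det M > 0" "p = proj_point (subst_quartic M f)"
    by (auto simp: proj_orbit_def)
  \<comment> \<open>Rescaling \<open>M\<close> to determinant 1 multiplies the new quartic by c^4,
    which does not move the projective point. As \<open>quartic_act\<close> substitutes the inverse
    matrix, the group element sought is \<open>matrix_inv B\<close>.\<close>
  define c where "c = 1 / sqrt (det M)"
  define B where "B = c *\<^sub>R M"
  have c: "c \<noteq> 0" "c\<^sup>2 * det M = 1"
    using M by (auto simp: c_def power_divide)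
  have B: "det B = 1"
    using c(2) by (simp add: B_def det_2 power2_eq_square algebra_simps)
  have "matrix_inv (matrix_inv B) = B"
    using SL2_matrix_inv[OF B] by (intro matrix_inv_eqI)
  then have "quartic_act (matrix_inv B) f = c ^ 4 *\<^sub>R subst_quartic M f"
    by (simp add: quartic_act_eq_subst B_def subst_quartic_scaleR_matrix)
  then have "p = proj_point (quartic_act (matrix_inv B) f)"
    using M c by (simp add: proj_point_scaleR)
  then show "p \<in> {proj_point (quartic_act A f) |A. det A = 1}"
    using SL2_matrix_inv(3)[OF B] by blast
qed

lemma orbit_PSL2:
  assumes f: "f \<noteq> 0" "qform f = 0"
  shows "orbit PSL2 PSL2_act (proj_point f) = proj_orbit f"
proof -
  have Ein: "proj_point f \<in> Ein"
    using f by (simp add: proj_point_in_Ein)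
  show ?thesis
    unfolding orbit_def carrier_PSL2 proj_orbit_SL2
    using PSL2_act_rcos[OF _ Ein] quartic_act_proj_point
    by (smt (verit) Collect_cong mem_Collect_eq)
qed

lemma proj_orbit_subset_Ein:
  assumes "f \<noteq> 0" "qform f = 0"
  shows "proj_orbit f \<subseteq> Ein"
  using assms subst_quartic_Ein by (auto simp: proj_orbit_def)

lemma proj_orbit_refl: "proj_point f \<in> proj_orbit f"
  unfolding proj_orbit_def
  by (rule CollectI, rule exI[of _ "mat 1"]) simp

lemma proj_orbit_memI:
  assumes "det M > 0" "subst_quartic M f = c *\<^sub>R g" "c \<noteq> 0"
  shows "proj_point g \<in> proj_orbit f"
proof -
  have "proj_point g = proj_point (subst_quartic M f)"
    using assms by (simp add: proj_point_scaleR)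
  then show ?thesis
    using assms(1) by (auto simp: proj_orbit_def)
qed

lemma proj_orbit_subst:
  assumes "det M > 0" "proj_point (subst_quartic M f) \<in> proj_orbit g" 
  shows "proj_point f \<in> proj_orbit g"
proof -
  obtain N where N: "det N > 0" "M ** N = mat 1"
    using pos_det_inverse[OF assms(1)] by metis
  obtain K where K: "det K > 0" "proj_point (subst_quartic M f) = proj_point (subst_quartic K g)"
    using assms by (auto simp: proj_orbit_def)
  show ?thesis
  \<comment> \<open>The zero quartic is treated apart: its span is \<open>{0}\<close>, and equality
    of the spans then forces g = 0.\<close>
  proof (cases "f = 0")
    case True
    then have "proj_point (subst_quartic K g) = {0}"
      using K by (simp add: proj_point_def)
    then have "subst_quartic K g = 0"
      unfolding proj_point_def by (metis singletonD singletonI span_base)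
    then have "proj_point f = proj_point g"
      using True K(1) by (simp add: subst_quartic_eq_0_iff)
    then show ?thesis
      by (simp add: proj_orbit_refl)
  next
    case False
    then obtain c where c: "c \<noteq> 0" "subst_quartic M f = c *\<^sub>R subst_quartic K g"
      using K(2) assms(1) proj_point_eqD subst_quartic_eq_0_iff by metis
    have "f = subst_quartic N (subst_quartic M f)"
      by (simp add: N subst_quartic_mult)
    also have "\<dots> = c *\<^sub>R subst_quartic (K ** N) g"
      by (simp add: c subst_quartic_scaleR subst_quartic_mult)
    finally have "proj_point f = proj_point (subst_quartic (K ** N) g)"
      using c by (metis proj_point_scaleR)
    moreover have "det (K ** N) > 0"
      using K N by (simp add: det_mul)
    ultimately show ?thesis
      by (auto simp: proj_orbit_def)
  qed
qed

text \<open>Counterpart of \<open>proj_orbit_memI\<close> for normalizations: the substitution leads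
  from the given quartic to the base point, and \<open>proj_orbit_subst\<close> supplies the
  inverse.\<close>

lemma proj_orbit_I:
  assumes "det M > 0" "subst_quartic M f = c *\<^sub>R g" "c \<noteq> 0"
  shows "proj_point f \<in> proj_orbit g"
  by (rule proj_orbit_subst[of M]) (use assms in \<open>simp_all add: proj_point_scaleR proj_orbit_refl\<close>)

lemma subst_mem_proj_orbit_iff:
  assumes "det M > 0"
  shows "proj_point (subst_quartic M f) \<in> proj_orbit g \<longleftrightarrow> proj_point f \<in> proj_orbit g"
proof -
  obtain N where N: "det N > 0" "M ** N = mat 1"
    using pos_det_inverse[OF assms(1)] by metis
  then show ?thesis
    using proj_orbit_subst[OF assms] proj_orbit_subst[of N "subst_quartic M f"]
    by (auto simp: subst_quartic_mult)
qed

lemma proj_orbit_eq: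
  assumes "proj_point f \<in> proj_orbit g"
  shows "proj_orbit f = proj_orbit g"
proof -
  obtain K where K: "det K > 0" "proj_point f = proj_point (subst_quartic K g)"
    using assms by (auto simp: proj_orbit_def)
  show ?thesis
  proof (intro equalityI subsetI)
    fix p assume "p \<in> proj_orbit f"
    then show "p \<in> proj_orbit g"
      using assms subst_mem_proj_orbit_iff unfolding proj_orbit_def[of f] by auto
  next
    have "proj_point g \<in> proj_orbit f"
      using K proj_orbit_refl proj_orbit_subst by metis
    then show "p \<in> proj_orbit f" if "p \<in> proj_orbit g" for p
      using that subst_mem_proj_orbit_iff unfolding proj_orbit_def[of g] by auto
  qed
qed

section \<open>Classification of the null quartics\<close>

text \<open>On null quartics it vanishes exactly at those with a root of multiplicity at least three.\<close>

definition catalecticant :: "quartic \<Rightarrow> real" where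
  "catalecticant f = f$4 * f$2 * f$0 / 6 + f$3 * f$2 * f$1 / 48 - (f$2)^3 / 216
     - f$0 * (f$3)\<^sup>2 / 16 - f$4 * (f$1)\<^sup>2 / 16"

text \<open>Dividing by the binomial coefficients 1, 4, 6, 4, 1 makes the entries constant along
  antidiagonals; this is the classical catalecticant matrix.\<close>

definition hankel :: "quartic \<Rightarrow> real ^ 3 ^ 3" where
  "hankel f = vector [vector [f$4, f$3 / 4, f$2 / 6], vector [f$3 / 4, f$2 / 6, f$1 / 4],
     vector [f$2 / 6, f$1 / 4, f$0]]"

lemma det_hankel: "det (hankel f) = catalecticant f"
  by (simp add: det_3 hankel_def catalecticant_def power2_eq_square power3_eq_cube algebra_simps)

text \<open>With $v = (X^2, 2XY, Y^2)$ one has $f = v^T H v$ for the Hankel matrix $H$ of $f$; the matrix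
  below is the action of the substitution on $v$.\<close>

definition sym2 :: "real ^ 2 ^ 2 \<Rightarrow> real ^ 3 ^ 3" where
  "sym2 M = (let p = M $ 1 $ 1; q = M $ 1 $ 2; r = M $ 2 $ 1; s = M $ 2 $ 2 in
     vector [vector [p\<^sup>2, p * q, q\<^sup>2], vector [2 * p * r, p * s + q * r, 2 * q * s],
       vector [r\<^sup>2, r * s, s\<^sup>2]])"

lemma det_sym2: "det (sym2 M) = det M ^ 3"
  by (simp add: det_3 det_2 sym2_def Let_def) algebra

text \<open>That the right side represents the new quartic is clear from the action on (X^2, 2XY,
  Y^2). But a quartic has many representing matrices, because (2XY)^2 = 4 X^2 Y^2; the point is that
  the congruence is again a Hankel matrix, which is checked entry by entry. Taking determinants
  makes J an invariant of weight 6.\<close>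

lemma hankel_subst: "hankel (subst_quartic M f) = transpose (sym2 M) ** hankel f ** sym2 M"
  unfolding vec_eq_iff forall_3
  by (intro conjI; simp add: matrix_matrix_mult_def transpose_def sum_3 hankel_def sym2_def
      subst_quartic_def Let_def field_simps; algebra)

lemma catalecticant_subst: "catalecticant (subst_quartic M f) = det M ^ 6 * catalecticant f"
  by (simp add: hankel_subst det_mul det_sym2 flip: det_hankel power_add)

lemma catalecticant_scaleR: "catalecticant (c *\<^sub>R f) = c ^ 3 * catalecticant f"
  by (simp add: catalecticant_def power2_eq_square power3_eq_cube algebra_simps)

abbreviation (input) X4 :: quartic where "X4 \<equiv> mk_quartic 1 0 0 0 0"
abbreviation (input) X3Y :: quartic where "X3Y \<equiv> mk_quartic 0 1 0 0 0"
abbreviation (input) X4XY3 :: quartic where "X4XY3 \<equiv> mk_quartic 1 0 0 1 0"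

section \<open>Normal forms of null quartics under positive substitutions\<close>

lemma subst_monic:
  assumes "f \<noteq> 0"
  obtains M where "det M > 0" "subst_quartic M f $ 4 \<noteq> 0"
proof -
  obtain v where v: "quartic_eval f v \<noteq> 0"
    using assms quartic_eval_inject[of f 0] by (auto simp: quartic_eval_def)
  \<comment> \<open>The first column is v, so the X^4 coefficient becomes the value at v; the second
    is v turned by a right angle, so the determinant is the squared length of v.\<close>
  define M where "M = mat2 (v $ 1) (- v $ 2) (v $ 2) (v $ 1)"
  have "v \<noteq> 0"
    using v by (auto simp: quartic_eval_def)
  then have "v $ 1 \<noteq> 0 \<or> v $ 2 \<noteq> 0"
    by (auto simp: vec_eq_iff forall_2)
  then have "det M > 0"
    by (simp add: M_def sum_squares_gt_zero_iff)
  moreover have "subst_quartic M f $ 4 = quartic_eval f v"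
    by (simp add: subst_quartic_def quartic_eval_def Let_def M_def)
  ultimately show thesis
    using v that by metis
qed

text \<open>Once the X^4 coefficient is nonzero, a shear in X removes the X^3 Y term. For the monic
  quartic the null equation then reads 2 a_0 + a_2^2 / 6 = 0, which leaves only b and c
  free.\<close>

lemma subst_depressed:
  assumes "f \<noteq> 0" "qform f = 0"
  obtains M b c k where "det M > 0" "k \<noteq> 0" "subst_quartic M f = k *\<^sub>R mk_quartic 1 0 c b (- c\<^sup>2 / 12)"
proof -
  obtain M where M: "det M > 0" "subst_quartic M f $ 4 \<noteq> 0"
    using subst_monic assms by blast
  define g where "g = subst_quartic M f"
  define k where "k = g $ 4"
  define N where "N = mat2 1 (- g $ 3 / (4 * k)) 0 1"
  define h where "h = (1 / k) *\<^sub>R subst_quartic N g"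
  have k: "k \<noteq> 0"
    using M by (simp add: k_def g_def)
  have "h $ 4 = 1" "h $ 3 = 0"
    using k by (simp_all add: h_def N_def subst_quartic_def Let_def flip: k_def)
  moreover have "qform h = 0"
    using assms by (simp add: h_def g_def qform_scaleR qform_subst)
  ultimately have "h = mk_quartic 1 0 (h $ 2) (h $ 1) (- (h $ 2)\<^sup>2 / 12)"
    by (simp add: quartic_eq_iff qform_def)
  then have "subst_quartic (M ** N) f = k *\<^sub>R mk_quartic 1 0 (h $ 2) (h $ 1) (- (h $ 2)\<^sup>2 / 12)"
    using k by (metis g_def h_def divide_self_if scaleR_one scaleR_scaleR subst_quartic_mult times_divide_eq_right mult.right_neutral)
  moreover have "det (M ** N) > 0"
    using M by (simp add: det_mul N_def)
  ultimately show thesis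
    using that k by blast
qed

text \<open>The quartic is (X + t Y)^4.\<close>

lemma X4_orbitI: "proj_point (mk_quartic 1 (4 * t) (6 * t\<^sup>2) (4 * t ^ 3) (t ^ 4)) \<in> proj_orbit X4"
  by (rule proj_orbit_memI[where M = "mat2 1 t 0 1" and c = 1]) (simp_all add: subst_quartic_def)

text \<open>The quartic is (X + s Y)^3 (X + t Y).\<close>

lemma X3Y_orbitI:
  assumes "s \<noteq> t"
  shows "proj_point (mk_quartic 1 (3 * s + t) (3 * s\<^sup>2 + 3 * s * t) (s ^ 3 + 3 * s\<^sup>2 * t) (s ^ 3 * t))
    \<in> proj_orbit X3Y"
proof (rule proj_orbit_memI)
  \<comment> \<open>The rows are the two linear factors; the extra factor t - s in the second row
    turns the determinant t - s into its square, positive for either order of s and t.\<close>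
  define M where "M = mat2 1 s (t - s) ((t - s) * t)"
  have "det M = (t - s)\<^sup>2"
    by (simp add: M_def power2_eq_square algebra_simps)
  then show "det M > 0"
    using assms by simp
  show "subst_quartic M X3Y =
      (t - s) *\<^sub>R mk_quartic 1 (3 * s + t) (3 * s\<^sup>2 + 3 * s * t) (s ^ 3 + 3 * s\<^sup>2 * t) (s ^ 3 * t)"
    by (simp add: subst_quartic_def Let_def M_def quartic_eq_iff) algebra
qed (use assms in simp)

text \<open>In depressed form the condition J = 0 becomes 27 b^2 = - 8 c^3, a cuspidal curve with
  parametrization c = - 6 s^2, b = - 8 s^3. Its points are the quartics (X + s Y)^3 (X - 3 s Y),
  with a quadruple root only for s = 0.\<close>

lemma proj_orbit_catalecticant_zero:
  assumes "f \<noteq> 0" "qform f = 0" "catalecticant f = 0"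
  shows "proj_point f \<in> proj_orbit X4 \<union> proj_orbit X3Y"
proof -
  obtain M b c k where M: "det M > 0" "k \<noteq> 0"
    "subst_quartic M f = k *\<^sub>R mk_quartic 1 0 c b (- c\<^sup>2 / 12)"
    by (rule subst_depressed[OF assms(1,2)])
  define g where "g = mk_quartic 1 0 c b (- c\<^sup>2 / 12)"
  have "k ^ 3 * catalecticant g = 0"
    using assms catalecticant_subst[of M f] by (simp add: M(3) g_def catalecticant_scaleR)
  then have "catalecticant g = 0"
    using M by simp
  then have b: "27 * b\<^sup>2 = - 8 * c ^ 3"
    by (simp add: g_def catalecticant_def power2_eq_square power3_eq_cube)
  then have "c ^ 3 \<le> 0"
    using zero_le_power2[of b] by linarith
  then have "c \<le> 0"
    by (metis not_le zero_less_power)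
  \<comment> \<open>This is the absolute value of the parameter s; the sign of b decides between s =
    r and s = - r.\<close>
  define r where "r = sqrt (- c / 6)"
  have r: "c = - 6 * r\<^sup>2"
    using \<open>c \<le> 0\<close> by (simp add: r_def)
  have "b\<^sup>2 = (8 * r ^ 3)\<^sup>2"
    using b unfolding r by algebra
  then have "b = 8 * r ^ 3 \<or> b = - (8 * r ^ 3)"
    by (simp only: power2_eq_iff)
  then obtain s where s: "c = - 6 * s\<^sup>2" "b = - 8 * s ^ 3"
    using r that[of r] that[of "- r"] by auto
  have "proj_point g \<in> proj_orbit X4 \<union> proj_orbit X3Y"
  proof (cases "s = 0")
    case True
    then show ?thesis
      by (simp add: g_def s proj_orbit_refl)
  next
    case False
    have "g = mk_quartic 1 (3 * s + (- 3 * s)) (3 * s\<^sup>2 + 3 * s * (- 3 * s)) (s ^ 3 + 3 * s\<^sup>2 * (- 3 * s)) (s ^ 3 * (- 3 * s))"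
      by (simp add: g_def s quartic_eq_iff power2_eq_square power3_eq_cube)
    then show ?thesis
      using X3Y_orbitI[of s "- 3 * s"] False by auto
  qed
  then have "proj_point (subst_quartic M f) \<in> proj_orbit X4 \<union> proj_orbit X3Y"
    using M by (simp add: g_def proj_point_scaleR)
  then show ?thesis
    using M(1) by (simp add: subst_mem_proj_orbit_iff)
qed

text \<open>The real roots \<open>0\<close> and \<open>- 1\<close> of $X(X^3+Y^3)$ are exchanged by an orientation-reversing
  projective map which preserves the two complex ones.\<close>

lemma subst_swap_X4XY3: "subst_quartic (mat2 1 1 2 (- 1)) X4XY3 = 9 *\<^sub>R X4XY3"
  by (simp add: subst_quartic_def quartic_eq_iff)

text \<open>A real root is moved to X = 0. Fixing it, a second shear together with the null equation
  leaves only the X^4 and X Y^3 terms, whose ratio is normalized by a real cube root.\<close>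

lemma proj_orbit_catalecticant_nonzero:
  assumes f: "f \<noteq> 0" "qform f = 0" "catalecticant f \<noteq> 0"
  shows "proj_point f \<in> proj_orbit X4XY3"
proof -
  obtain M b c k where M: "det M > 0" "k \<noteq> 0"
    "subst_quartic M f = k *\<^sub>R mk_quartic 1 0 c b (- c\<^sup>2 / 12)"
    by (rule subst_depressed[OF f(1,2)])
  define g where "g = mk_quartic 1 0 c b (- c\<^sup>2 / 12)"
  have g: "qform g = 0" "catalecticant g \<noteq> 0"
    using f M catalecticant_subst[of M f]
    by (auto simp: g_def qform_def catalecticant_scaleR)
  have "\<exists>t. t ^ 4 + c * t\<^sup>2 + b * t - c\<^sup>2 / 12 = 0"
  proof -
    define P where "P = (\<lambda>t. t ^ 4 + c * t\<^sup>2 + b * t - c\<^sup>2 / 12)"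
    \<comment> \<open>For t at least 1 every lower term is bounded by its coefficient times t^3, so
      t^4 dominates as soon as t exceeds the sum of these coefficients.\<close>
    define t where "t = 1 + \<bar>b\<bar> + \<bar>c\<bar> + c\<^sup>2"
    have t: "t \<ge> 1" "t \<ge> \<bar>b\<bar> + \<bar>c\<bar> + c\<^sup>2"
      by (auto simp: t_def)
    have "- (c * t\<^sup>2) \<le> \<bar>c\<bar> * t ^ 3"
      using t by (smt (verit, best) mult_minus_left mult_mono power_increasing abs_ge_zero one_le_power zero_le_power numeral_le_iff semiring_norm)
    moreover have "- (b * t) \<le> \<bar>b\<bar> * t ^ 3"
      using t by (smt (verit, best) mult_minus_left mult_mono self_le_power abs_ge_zero zero_less_numeral)
    moreover have "c\<^sup>2 / 12 \<le> c\<^sup>2 * t ^ 3"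
      using mult_left_mono[OF one_le_power[OF t(1), of 3], of "c\<^sup>2"] zero_le_power2[of c]
      by linarith
    moreover have "(\<bar>b\<bar> + \<bar>c\<bar> + c\<^sup>2) * t ^ 3 \<le> t * t ^ 3"
      using t by (intro mult_right_mono) auto
    ultimately have "P t \<ge> 0"
      by (simp add: P_def algebra_simps power_numeral_reduce)
    \<comment> \<open>Nullity enters here: it makes the constant term - c^2 / 12, and thereby forces
      a real root.\<close>
    moreover have "P 0 \<le> 0"
      by (simp add: P_def)
    moreover have "continuous_on {0..t} P"
      unfolding P_def by (intro continuous_intros)
    ultimately show ?thesis
      using IVT'[of P 0 0 t] t unfolding P_def by auto
  qed
  then obtain t where t: "t ^ 4 + c * t\<^sup>2 + b * t - c\<^sup>2 / 12 = 0"
    by blast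
  \<comment> \<open>The translation by the root makes X a factor.\<close>
  define h where "h = subst_quartic (mat2 1 t 0 1) g"
  have h0: "h $ 0 = 0"
    using t by (simp add: h_def subst_quartic_def g_def algebra_simps)
  have h: "qform h = 0" "catalecticant h \<noteq> 0"
    using g by (simp_all add: h_def qform_subst catalecticant_subst)
  \<comment> \<open>If X divided h twice, nullity would make it divide h three times, and J would
    vanish.\<close>
  have h1: "h $ 1 \<noteq> 0"
  proof
    assume "h $ 1 = 0"
    then have "h $ 2 = 0"
      using h(1) h0 by (simp add: qform_def)
    then show False
      using h(2) h0 \<open>h $ 1 = 0\<close> by (simp add: catalecticant_def)
  qed
  \<comment> \<open>This shear in Y keeps the factor X and removes the X^2 Y^2 term; the null
    equation reduces to a_1 a_3 = 0 and removes the X^3 Y term as well.\<close>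
  define u where "u = subst_quartic (mat2 1 0 (- h $ 2 / (3 * h $ 1)) 1) h"
  have u_eqs: "u $ 0 = 0" "u $ 1 = h $ 1" "u $ 2 = 0"
    using h0 h1 by (simp_all add: u_def subst_quartic_def)
  have u: "qform u = 0" "catalecticant u \<noteq> 0"
    using h by (simp_all add: u_def qform_subst catalecticant_subst)
  have u3: "u $ 3 = 0" and u4: "u $ 4 \<noteq> 0"
    using u u_eqs h1 by (auto simp: qform_def catalecticant_def)
  define l where "l = root 3 (u $ 1 / u $ 4)"
  have l: "l \<noteq> 0" "l ^ 3 * u $ 4 = u $ 1"
    using u4 u_eqs h1 by (auto simp: l_def odd_real_root_pow)
  have scaled: "subst_quartic (mat2 l 0 0 1) u = (l * u $ 1) *\<^sub>R X4XY3"
    using u_eqs u3 l by (simp add: subst_quartic_def quartic_eq_iff) algebra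
  have "proj_point u \<in> proj_orbit X4XY3"
  proof (cases "l > 0")
    case True
    then show ?thesis
      using l(1) u_eqs h1 by (intro proj_orbit_I[OF _ scaled]) auto
  next
    \<comment> \<open>The scaling by a negative l reverses orientation; composing with the swap of
      determinant - 3 makes the determinant positive.\<close>
    case False
    show ?thesis
    proof (rule proj_orbit_I)
      show "det (mat2 l 0 0 1 ** mat2 1 1 2 (- 1)) > 0"
        using False l(1) by (simp add: det_mul)
      show "subst_quartic (mat2 l 0 0 1 ** mat2 1 1 2 (- 1)) u = (l * u $ 1 * 9) *\<^sub>R X4XY3"
        by (simp add: scaled subst_quartic_scaleR subst_swap_X4XY3 flip: subst_quartic_mult)
    qed (use l(1) u_eqs h1 in simp)
  qed
  then have "proj_point g \<in> proj_orbit X4XY3"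
    by (simp add: u_def h_def subst_mem_proj_orbit_iff)
  then have "proj_point (subst_quartic M f) \<in> proj_orbit X4XY3"
    using M by (simp add: g_def proj_point_scaleR)
  then show ?thesis
    using M(1) by (simp add: subst_mem_proj_orbit_iff)
qed

text \<open>This turns membership into the nonvanishing of one invariant, from which the
  distinctness of the orbits, the domain of the chart and the openness are read off.\<close>

lemma proj_orbit_X4XY3:
  "proj_orbit X4XY3 = {proj_point f |f. f \<noteq> 0 \<and> qform f = 0 \<and> catalecticant f \<noteq> 0}"
proof (intro equalityI subsetI)
  fix p assume "p \<in> proj_orbit X4XY3"
  then obtain M where M: "det M > 0" "p = proj_point (subst_quartic M X4XY3)"
    by (auto simp: proj_orbit_def)
  moreover have "X4XY3 \<noteq> 0" "qform X4XY3 = 0" "catalecticant X4XY3 \<noteq> 0"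
    by (auto simp: quartic_eq_iff qform_def catalecticant_def)
  ultimately have "subst_quartic M X4XY3 \<noteq> 0" "qform (subst_quartic M X4XY3) = 0"
      "catalecticant (subst_quartic M X4XY3) \<noteq> 0"
    by (auto simp: subst_quartic_eq_0_iff qform_subst catalecticant_subst)
  then show "p \<in> {proj_point f |f. f \<noteq> 0 \<and> qform f = 0 \<and> catalecticant f \<noteq> 0}"
    using M by blast
qed (auto intro: proj_orbit_catalecticant_nonzero)

lemma orbits_PSL2: "orbits PSL2 Ein PSL2_act = {proj_orbit X4, proj_orbit X3Y, proj_orbit X4XY3}"
proof -
  have null: "X4 \<noteq> 0" "qform X4 = 0" "X3Y \<noteq> 0" "qform X3Y = 0" "X4XY3 \<noteq> 0" "qform X4XY3 = 0"
    by (auto simp: quartic_eq_iff qform_def)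
  have "orbits PSL2 Ein PSL2_act = {proj_orbit f |f. f \<noteq> 0 \<and> qform f = 0}"
    unfolding orbits_def Ein_def using orbit_PSL2 by (smt (verit) Collect_cong mem_Collect_eq)
  also have "\<dots> = {proj_orbit X4, proj_orbit X3Y, proj_orbit X4XY3}"
    using null proj_orbit_catalecticant_zero proj_orbit_catalecticant_nonzero proj_orbit_eq by blast
  finally show ?thesis .
qed

lemma proj_orbits_distinct:
  "proj_orbit X4 \<noteq> proj_orbit X3Y" "proj_orbit X4 \<noteq> proj_orbit X4XY3" "proj_orbit X3Y \<noteq> proj_orbit X4XY3"
proof -
  have *: "proj_point f \<notin> proj_orbit X4XY3" if "f \<noteq> 0" "catalecticant f = 0" for f
  proof
    assume "proj_point f \<in> proj_orbit X4XY3"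
    then obtain g where "proj_point f = proj_point g" "catalecticant g \<noteq> 0"
      unfolding proj_orbit_X4XY3 by blast
    then show False
      using that by (metis proj_point_eqD catalecticant_scaleR mult_eq_0_iff power_not_zero)
  qed
  show "proj_orbit X4 \<noteq> proj_orbit X4XY3" "proj_orbit X3Y \<noteq> proj_orbit X4XY3"
    using *[of X4] *[of X3Y] proj_orbit_refl by (auto simp: quartic_eq_iff catalecticant_def)
  have "proj_point X3Y \<notin> proj_orbit X4"
  proof
    assume "proj_point X3Y \<in> proj_orbit X4"
    then obtain M where "proj_point X3Y = proj_point (subst_quartic M X4)"
      by (auto simp: proj_orbit_def)
    then obtain c where "X3Y = c *\<^sub>R subst_quartic M X4"
      by (rule proj_point_eqD) (simp add: quartic_eq_iff)
    \<comment> \<open>A multiple of (p X + q Y)^4 without X^4 term has no X^3 Y term either.\<close>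
    then show False
      by (auto simp: quartic_eq_iff subst_quartic_def Let_def)
  qed
  then show "proj_orbit X4 \<noteq> proj_orbit X3Y"
    using proj_orbit_refl by blast
qed

section \<open>Stabilizers in the open orbit\<close>

lemma cube_inject: "x ^ 3 = y ^ 3 \<Longrightarrow> x = y" for x y :: real
  by (metis odd_numeral odd_real_root_power_cancel)

text \<open>The root (0, 1) is mapped to the real root (q, s). If it is fixed, then q = 0, and the
  remaining equations make M diagonal and then scalar. If it is exchanged with the root (1, - 1),
  then s = - q, and M becomes a multiple of the orientation-reversing swap.\<close>

lemma subst_stabilizer_X4XY3:
  assumes "det M = 1" "subst_quartic M X4XY3 = c *\<^sub>R X4XY3"
  shows "M = mat 1 \<or> M = - mat 1"
proof -
  define p q r s where "p = M $ 1 $ 1" "q = M $ 1 $ 2" "r = M $ 2 $ 1" "s = M $ 2 $ 2"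
  note pqrs = this
  have det: "p * s - q * r = 1"
    using assms(1) by (simp add: det_2 pqrs)
  have eqs: "p ^ 4 + p * r ^ 3 = c" "4 * p ^ 3 * q + 3 * p * r\<^sup>2 * s + q * r ^ 3 = 0"
    "6 * p\<^sup>2 * q\<^sup>2 + 3 * p * r * s\<^sup>2 + 3 * q * r\<^sup>2 * s = 0"
    "4 * p * q ^ 3 + p * s ^ 3 + 3 * q * r * s\<^sup>2 = c" "q ^ 4 + q * s ^ 3 = 0"
    using assms(2) by (simp_all add: subst_quartic_def quartic_eq_iff Let_def pqrs algebra_simps)
  have "q = 0"
  proof (rule ccontr)
    assume q: "q \<noteq> 0"
    have "q * (q ^ 3 + s ^ 3) = 0"
      using eqs(5) by algebra
    then have "s ^ 3 = (- q) ^ 3"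
      using q by simp
    then have s: "s = - q"
      by (rule cube_inject)
    have "3 * q\<^sup>2 * (2 * p - r) * (p + r) = 0"
      using eqs(3) unfolding s by algebra
    moreover have "p + r \<noteq> 0"
      using det s by algebra
    ultimately have r: "r = 2 * p"
      using q by simp
    have "p \<noteq> 0"
      using det r by auto
    moreover have "9 * p * (q ^ 3 - p ^ 3) = 0"
      using eqs(1,4) unfolding r s
      by (simp add: power2_eq_square power3_eq_cube power4_eq_xxxx algebra_simps)
    ultimately have "q ^ 3 = p ^ 3"
      by simp
    then have "q = p"
      by (rule cube_inject)
    \<comment> \<open>At this point M is p times \<open>mat2 1 1 2 (- 1)\<close>, whose determinant
      is negative.\<close>
    then have "- 3 * p\<^sup>2 = 1"
      using det unfolding r s by (simp add: power2_eq_square)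
    then show False
      using zero_le_power2[of p] by linarith
  qed
  have ps: "p * s = 1"
    using det \<open>q = 0\<close> by simp
  have "r = 0"
    using eqs(3) \<open>q = 0\<close> ps by auto
  have "p * (p ^ 3 - s ^ 3) = 0"
    using eqs(1,4) \<open>q = 0\<close> \<open>r = 0\<close> by (simp add: power3_eq_cube power4_eq_xxxx algebra_simps)
  then have "p ^ 3 = s ^ 3"
    using ps by auto
  then have "p = s"
    by (rule cube_inject)
  then have "p\<^sup>2 = 1 \<and> s = p"
    using ps by (simp add: power2_eq_square)
  then have "p = 1 \<and> s = 1 \<or> p = - 1 \<and> s = - 1"
    by (auto simp: power2_eq_1_iff)
  then show ?thesis
    using \<open>q = 0\<close> \<open>r = 0\<close> by (auto simp: pqrs vec_eq_iff forall_2 mat_def)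
qed

text \<open>If A fixes the point obtained from the base point by B, then the inverse of B^{-1} A B,
  written \<open>matrix_inv (A ** B) ** B\<close>, fixes the base point and so is 1 or - 1. These
  are central, hence A is 1 or - 1.\<close>

lemma stabilizer_open_orbit:
  assumes "p \<in> proj_orbit X4XY3"
  shows "stabilizer PSL2 PSL2_act p = {\<one>\<^bsub>PSL2\<^esub>}"
proof -
  interpret group_action PSL2 Ein PSL2_act
    by (rule PSL2_group_action)
  have null: "X4XY3 \<noteq> 0" "qform X4XY3 = 0"
    by (auto simp: quartic_eq_iff qform_def)
  have p_Ein: "p \<in> Ein"
    using assms proj_orbit_subset_Ein[OF null] by blast
  have "p \<in> orbit PSL2 PSL2_act (proj_point X4XY3)"
    using assms orbit_PSL2[OF null] by simp
  then obtain B where B: "det B = 1" "p = proj_point (quartic_act B X4XY3)"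
    unfolding orbit_def carrier_PSL2 using null
    by (auto simp: PSL2_act_rcos proj_point_in_Ein quartic_act_proj_point)
  have one: "\<one>\<^bsub>PSL2\<^esub> = {mat 1, - mat 1}"
    by (simp add: PSL2_def)
  have "g = \<one>\<^bsub>PSL2\<^esub>" if g: "g \<in> carrier PSL2" "PSL2_act g p = p" for g
  proof -
    obtain A where A: "det A = 1" "g = {A, - A}"
      using g(1) carrier_PSL2 by auto
    have "proj_point (quartic_act (A ** B) X4XY3) = proj_point (quartic_act B X4XY3)"
      using g(2) A B p_Ein by (simp add: PSL2_act_rcos quartic_act_proj_point quartic_act_mult)
    moreover have "quartic_act (A ** B) X4XY3 \<noteq> 0"
      using A B null SL2_matrix_inv(3)[of "A ** B"] by (simp add: quartic_act_eq_subst subst_quartic_eq_0_iff det_mul)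
    ultimately obtain c where "quartic_act (A ** B) X4XY3 = c *\<^sub>R quartic_act B X4XY3"
      using proj_point_eqD by metis
    then have "subst_quartic B (quartic_act (A ** B) X4XY3) = c *\<^sub>R X4XY3"
      using SL2_matrix_inv[OF B(1)] by (simp add: quartic_act_eq_subst subst_quartic_scaleR subst_quartic_mult)
    then have "subst_quartic (matrix_inv (A ** B) ** B) X4XY3 = c *\<^sub>R X4XY3"
      by (simp add: quartic_act_eq_subst subst_quartic_mult)
    moreover have AB: "det (A ** B) = 1"
      using A B by (simp add: det_mul)
    then have "det (matrix_inv (A ** B) ** B) = 1"
      using SL2_matrix_inv(3) B by (simp add: det_mul)
    ultimately have "matrix_inv (A ** B) ** B = mat 1 \<or> matrix_inv (A ** B) ** B = - mat 1"
      using subst_stabilizer_X4XY3 by blast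
    moreover have "B = (A ** B) ** (matrix_inv (A ** B) ** B)"
      by (simp add: matrix_mul_assoc SL2_matrix_inv(1)[OF AB])
    ultimately have "B = A ** B \<or> B = - (A ** B)"
      by (auto simp: mat_uminus_mult)
    then have "A ** B = B \<or> A ** B = - B"
      by (metis minus_minus)
    moreover have "A = (A ** B) ** matrix_inv B"
      by (simp add: SL2_matrix_inv(1)[OF B(1)] flip: matrix_mul_assoc)
    ultimately have "A = mat 1 \<or> A = - mat 1"
      using SL2_matrix_inv(1)[OF B(1)] by (auto simp: mat_uminus_mult)
    then show ?thesis
      using A by (auto simp: one)
  qed
  moreover have "PSL2_act \<one>\<^bsub>PSL2\<^esub> p = p"
    using id_eq_one p_Ein by (metis restrict_apply)
  moreover have "\<one>\<^bsub>PSL2\<^esub> \<in> carrier PSL2"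
    using group_hom group_hom.axioms(1) group.is_monoid monoid.one_closed by blast
  ultimately show ?thesis
    unfolding stabilizer_def by blast
qed

section \<open>Polynomial maps are smooth\<close>

text \<open>The second conclusion keeps directional derivatives inside the class of polynomials;
  this is what drives the induction on the order of differentiability.\<close>

lemma real_polynomial_function_has_derivative:
  assumes "real_polynomial_function p"
  obtains D where "\<And>x. (p has_derivative D x) (at x)" "\<And>v. real_polynomial_function (\<lambda>x. D x v)"
proof -
  have "\<exists>D. (\<forall>x. (p has_derivative D x) (at x)) \<and> (\<forall>v. real_polynomial_function (\<lambda>x. D x v))"
    using assms
  proof (induction p rule: real_polynomial_function.induct)
    case (linear f)
    then show ?case
      by (intro exI[of _ "\<lambda>x. f"]) (auto intro: bounded_linear_imp_has_derivative)
  next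
    case (const c)
    show ?case
      by (intro exI[of _ "\<lambda>x v. 0"]) auto
  next
    case (add f g)
    then obtain D E where "\<forall>x. (f has_derivative D x) (at x)" "\<forall>v. real_polynomial_function (\<lambda>x. D x v)"
      "\<forall>x. (g has_derivative E x) (at x)" "\<forall>v. real_polynomial_function (\<lambda>x. E x v)"
      by blast
    then show ?case
      by (intro exI[of _ "\<lambda>x v. D x v + E x v"]) (auto intro: derivative_intros)
  next
    case (mult f g)
    then obtain D E where "\<forall>x. (f has_derivative D x) (at x)" "\<forall>v. real_polynomial_function (\<lambda>x. D x v)"
      "\<forall>x. (g has_derivative E x) (at x)" "\<forall>v. real_polynomial_function (\<lambda>x. E x v)"
      by blast
    with mult.hyps show ?case
      by (intro exI[of _ "\<lambda>x v. f x * E x v + D x v * g x"]) (intro conjI allI real_polynomial_function.intros(3,4) has_derivative_mult; simp)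
  qed
  then show thesis
    using that by blast
qed

lemma polynomial_function_frechet_derivative:
  fixes f :: "'a::euclidean_space \<Rightarrow> 'b::euclidean_space"
  assumes "polynomial_function f"
  shows "polynomial_function (\<lambda>x. frechet_derivative f (at x) v)"
proof -
  have "\<forall>b\<in>Basis. \<exists>D. (\<forall>x. ((\<lambda>x. f x \<bullet> b) has_derivative D x) (at x)) \<and>
      real_polynomial_function (\<lambda>x. D x v)"
    using assms real_polynomial_function_has_derivative
    unfolding polynomial_function_iff_Basis_inner by metis
  then obtain D where D: "\<And>b x. b \<in> Basis \<Longrightarrow> ((\<lambda>x. f x \<bullet> b) has_derivative D b x) (at x)"
    "\<And>b. b \<in> Basis \<Longrightarrow> real_polynomial_function (\<lambda>x. D b x v)"
    by metis
  have "frechet_derivative f (at x) v \<bullet> b = D b x v" if "b \<in> Basis" for b x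
  proof -
    have "f differentiable (at x)"
      using assms by (rule differentiable_at_polynomial_function)
    then have "((\<lambda>x. f x \<bullet> b) has_derivative (\<lambda>w. frechet_derivative f (at x) w \<bullet> b)) (at x)"
      by (intro has_derivative_inner_left) (simp add: frechet_derivative_works)
    then show ?thesis
      using D(1)[OF that] by (metis has_derivative_unique)
  qed
  then show ?thesis
    using D(2) by (simp add: polynomial_function_iff_Basis_inner)
qed

lemma polynomial_function_smooth_on:
  fixes f :: "'a::euclidean_space \<Rightarrow> 'b::euclidean_space"
  assumes "polynomial_function f"
  shows "smooth_on S f"
proof -
  have "Ck_on k S f" for k
    using assms
  proof (induction k arbitrary: f)
    case 0
    then show ?case
      by (simp add: continuous_on_polymonial_function)
  next
    case (Suc k)
    then show ?case
      by (simp add: differentiable_at_polynomial_function polynomial_function_frechet_derivative)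
  qed
  then show ?thesis
    by (simp add: smooth_on_def)
qed

text \<open>Expansion in the monomials reduces polynomiality and differentiation to the closure
  rules for sums and scalar multiples.\<close>

lemma mk_quartic_eq:
  "mk_quartic e d c b a = e *\<^sub>R mk_quartic 1 0 0 0 0 + d *\<^sub>R mk_quartic 0 1 0 0 0 +
     c *\<^sub>R mk_quartic 0 0 1 0 0 + b *\<^sub>R mk_quartic 0 0 0 1 0 + a *\<^sub>R mk_quartic 0 0 0 0 1"
  by (simp add: quartic_eq_iff)

lemma polynomial_function_mk_quartic:
  assumes "real_polynomial_function e" "real_polynomial_function d" "real_polynomial_function c"
    "real_polynomial_function b" "real_polynomial_function a"
  shows "polynomial_function (\<lambda>x. mk_quartic (e x) (d x) (c x) (b x) (a x))"
  unfolding mk_quartic_eq[of "e _"]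
  by (intro polynomial_function_add polynomial_function_mult polynomial_function_const)
    (use assms in \<open>simp_all add: real_polynomial_function_eq\<close>)

lemma real_polynomial_function_nth [intro]: "real_polynomial_function (\<lambda>x::real^'n. x $ i)"
  by (simp add: real_polynomial_function_eq polynomial_function_bounded_linear bounded_linear_vec_nth)

lemma has_derivative_mk_quartic:
  assumes "(e has_derivative e') F" "(d has_derivative d') F" "(c has_derivative c') F"
    "(b has_derivative b') F" "(a has_derivative a') F"
  shows "((\<lambda>x. mk_quartic (e x) (d x) (c x) (b x) (a x)) has_derivative
     (\<lambda>w. mk_quartic (e' w) (d' w) (c' w) (b' w) (a' w))) F"
  unfolding mk_quartic_eq[of "e _"] mk_quartic_eq[of "e' _"]
  using assms by (auto intro!: derivative_intros)

section \<open>Topology of the projective space\<close>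

lemma topspace_proj_topology: "topspace proj_topology = proj_space"
proof -
  have "{f. f \<noteq> 0 \<and> proj_point f \<in> proj_space} = - {0}"
    by (auto simp: proj_space_def)
  then have "openin proj_topology proj_space"
    by (simp add: openin_proj_topology open_Compl)
  then show ?thesis
    by (metis openin_proj_topology openin_subset openin_topspace subset_antisym)
qed

lemma continuous_map_proj_point: "continuous_map (top_of_set (- {0})) proj_topology proj_point"
proof -
  have "openin (top_of_set (- {0})) {f \<in> - {0}. proj_point f \<in> U}" if "openin proj_topology U" for U
  proof -
    have "{f \<in> - {0}. proj_point f \<in> U} = {f. f \<noteq> 0 \<and> proj_point f \<in> U}"
      by auto
    then show ?thesis
      using that by (auto simp: openin_proj_topology open_openin_trans open_Compl)
  qed
  then show ?thesis
    by (auto simp: continuous_map_def topspace_proj_topology proj_space_def)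
qed

text \<open>The saturation of an open set is the union of its nonzero multiples. Openness of the
  projection lets second countability descend to the quotient.\<close>

lemma open_map_proj_point: "open_map (top_of_set (- {0})) proj_topology proj_point"
  unfolding open_map_def
proof (intro allI impI)
  fix U :: "quartic set" assume "openin (top_of_set (- {0})) U"
  then have U: "open U" "U \<subseteq> - {0}"
    by (auto simp: openin_open_eq open_Compl)
  have "{f. f \<noteq> 0 \<and> proj_point f \<in> proj_point ` U} = (\<Union>c\<in>- {0}. (\<lambda>f. c *\<^sub>R f) ` U)"
  proof (intro equalityI subsetI)
    fix f assume "f \<in> {f. f \<noteq> 0 \<and> proj_point f \<in> proj_point ` U}"
    then obtain g where "f \<noteq> 0" "g \<in> U" "proj_point f = proj_point g"
      by auto
    then show "f \<in> (\<Union>c\<in>- {0}. (\<lambda>f. c *\<^sub>R f) ` U)"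
      by (metis ComplI UN_I image_eqI proj_point_eqD singletonD)
  qed (use U in \<open>auto simp: proj_point_scaleR\<close>)
  moreover have "open (\<Union>c\<in>- {0}. (\<lambda>f. c *\<^sub>R f) ` U)"
    using U by (intro open_UN ballI open_scaling) auto
  ultimately show "openin proj_topology (proj_point ` U)"
    using U by (auto simp: openin_proj_topology proj_space_def)
qed

lemma second_countable_euclidean: "second_countable (euclidean :: 'a::second_countable_topology topology)"
proof -
  obtain B :: "'a set set" where B: "countable B" "\<And>C. C \<in> B \<Longrightarrow> open C"
    "\<And>S. open S \<Longrightarrow> \<exists>U. U \<subseteq> B \<and> S = \<Union>U"
    using univ_second_countable by blast
  have "\<exists>V\<in>B. x \<in> V \<and> V \<subseteq> U" if "open U" "x \<in> U" for U x
    using B(3)[OF that(1)] that(2) by blast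
  then show ?thesis
    using B(1,2) by (auto simp: second_countable_def intro!: exI[of _ B])
qed

lemma second_countable_proj_topology: "second_countable proj_topology"
proof (rule second_countable_open_map_image)
  show "second_countable (top_of_set (- {0 :: quartic}))"
    by (intro second_countable_subtopology) (rule second_countable_euclidean)
  show "proj_point ` topspace (top_of_set (- {0})) = topspace proj_topology"
    by (simp add: topspace_proj_topology proj_space_def)
qed (rule continuous_map_proj_point open_map_proj_point)+

section \<open>The affine chart a_4 = 1\<close>

definition affine_part :: "quartic set set" where
  "affine_part = {proj_point f |f. f $ 4 \<noteq> 0}"

definition affine_rep :: "quartic set \<Rightarrow> quartic" where
  "affine_rep p = (THE f. f $ 4 = 1 \<and> p = proj_point f)"

lemma affine_rep_proj_point:
  assumes "f $ 4 \<noteq> 0"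
  shows "affine_rep (proj_point f) = (1 / f $ 4) *\<^sub>R f"
  unfolding affine_rep_def
proof (rule the_equality)
  show "((1 / f $ 4) *\<^sub>R f) $ 4 = 1 \<and> proj_point f = proj_point ((1 / f $ 4) *\<^sub>R f)"
    using assms by (simp add: proj_point_scaleR)
next
  fix g assume g: "g $ 4 = 1 \<and> proj_point f = proj_point g"
  then obtain c where "f = c *\<^sub>R g"
    using assms proj_point_eqD by (metis zero_index)
  then show "g = (1 / f $ 4) *\<^sub>R f"
    using g assms by auto
qed

lemma proj_point_in_affine_part:
  assumes "f \<noteq> 0"
  shows "proj_point f \<in> affine_part \<longleftrightarrow> f $ 4 \<noteq> 0"
  unfolding affine_part_def using proj_point_eqD[OF _ assms] by fastforce

lemma openin_affine_part: "openin proj_topology affine_part"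
proof -
  have "{f. f \<noteq> 0 \<and> proj_point f \<in> affine_part} = {f. f $ 4 \<noteq> 0}"
    using proj_point_in_affine_part by (smt (verit) Collect_cong zero_index)
  moreover have "open {f :: quartic. f $ 4 \<noteq> 0}"
    by (intro open_Collect_neq continuous_intros)
  ultimately show ?thesis
    by (auto simp: openin_proj_topology affine_part_def proj_space_def)
qed

text \<open>In the quotient topology continuity is tested on lifts, where the map is division by the
  X^4 coefficient.\<close>

lemma continuous_map_affine_rep:
  "continuous_map (subtopology proj_topology affine_part) euclidean affine_rep"
proof -
  have "openin proj_topology {p \<in> affine_part. affine_rep p \<in> V}" if "open V" for V
  proof -
    have "{f. f \<noteq> 0 \<and> proj_point f \<in> {p \<in> affine_part. affine_rep p \<in> V}} =
        {f. f $ 4 \<noteq> 0 \<and> (1 / f $ 4) *\<^sub>R f \<in> V}" (is "_ = ?S")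
    proof (intro Collect_cong)
      show "f \<noteq> 0 \<and> proj_point f \<in> {p \<in> affine_part. affine_rep p \<in> V} \<longleftrightarrow>
          f $ 4 \<noteq> 0 \<and> (1 / f $ 4) *\<^sub>R f \<in> V" for f
        by (cases "f = 0") (auto simp: proj_point_in_affine_part affine_rep_proj_point)
    qed
    moreover have "open ?S"
    proof -
      have "open {f :: quartic. f $ 4 \<noteq> 0}"
        by (intro open_Collect_neq continuous_intros)
      moreover have "continuous_on {f :: quartic. f $ 4 \<noteq> 0} (\<lambda>f. (1 / f $ 4) *\<^sub>R f)"
        by (intro continuous_intros) auto
      ultimately have "open ((\<lambda>f. (1 / f $ 4) *\<^sub>R f) -` V \<inter> {f :: quartic. f $ 4 \<noteq> 0})"
        using that by (simp add: continuous_on_open_vimage)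
      moreover have "(\<lambda>f. (1 / f $ 4) *\<^sub>R f) -` V \<inter> {f :: quartic. f $ 4 \<noteq> 0} = ?S"
        by auto
      ultimately show ?thesis
        by simp
    qed
    ultimately show ?thesis
      by (auto simp: openin_proj_topology affine_part_def proj_space_def)
  qed
  moreover have "topspace proj_topology \<inter> affine_part = affine_part"
    using openin_subset[OF openin_affine_part] by blast
  ultimately show ?thesis
    by (auto simp: continuous_map_def openin_open_subtopology openin_affine_part)
qed

section \<open>Parametrizations in the affine part\<close>

text \<open>Since \<open>\<phi>\<close> is monic, its derivative has no X^4 term and can be a
  multiple of \<open>\<phi> u\<close> only if it is zero; so plain injectivity of the derivative
  gives an immersion. The inverse homeomorphism is \<open>h \<circ> affine_rep\<close>, and the
  image is open because the affine part is.\<close>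

lemma local_param_affine:
  fixes \<phi> :: "real ^ 'n \<Rightarrow> quartic"
  assumes S: "S \<subseteq> Ein" and U: "open U" and poly: "polynomial_function \<phi>"
    and monic: "\<And>u. \<phi> u $ 4 = 1" and null: "\<And>u. u \<in> U \<Longrightarrow> qform (\<phi> u) = 0"
    and inj: "\<And>u w. u \<in> U \<Longrightarrow> frechet_derivative \<phi> (at u) w = 0 \<Longrightarrow> w = 0"
    and image: "(proj_point \<circ> \<phi>) ` U = S \<inter> affine_part"
    and left_inv: "\<And>u. u \<in> U \<Longrightarrow> h (\<phi> u) = u" and cont: "continuous_on (\<phi> ` U) h"
  shows "local_param (subtopology Ein_topology S) U \<phi>"
proof -
  have nz: "\<phi> u \<noteq> 0" for u
    using monic[of u] by auto
  have diff: "(\<phi> has_derivative frechet_derivative \<phi> (at u)) (at u)" for u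
    using differentiable_at_polynomial_function[OF poly] frechet_derivative_works by blast
  have coeff4: "frechet_derivative \<phi> (at u) w $ 4 = 0" for u w
  proof -
    have "((\<lambda>u. \<phi> u $ 4) has_derivative (\<lambda>w. frechet_derivative \<phi> (at u) w $ 4)) (at u)"
      using bounded_linear.has_derivative[OF bounded_linear_vec_nth diff] .
    moreover have "((\<lambda>u. \<phi> u $ 4) has_derivative (\<lambda>w. 0)) (at u)"
      by (simp add: monic)
    ultimately show ?thesis
      by (metis has_derivative_unique)
  qed
  have "w = 0" if "u \<in> U" and span: "frechet_derivative \<phi> (at u) w \<in> span {\<phi> u}" for u w
  proof -
    obtain c where c: "frechet_derivative \<phi> (at u) w = c *\<^sub>R \<phi> u"
      using span by (auto simp: span_singleton)
    then have "c = 0"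
      using coeff4[of u w] monic[of u] by simp
    then show ?thesis
      using c inj \<open>u \<in> U\<close> by simp
  qed
  then have imm: "Ein_immersion U \<phi>"
    using U null nz by (simp add: Ein_immersion_def polynomial_function_smooth_on[OF poly])
  define T where "T = subtopology Ein_topology S"
  have T: "T = subtopology proj_topology S"
    using S by (simp add: T_def Ein_topology_def subtopology_subtopology inf.absorb2)
  have open_image: "openin T ((proj_point \<circ> \<phi>) ` U)"
    unfolding image T by (metis openin_affine_part openin_subtopology_Int inf_commute)
  have T_image: "subtopology T ((proj_point \<circ> \<phi>) ` U) = subtopology proj_topology (S \<inter> affine_part)"
    unfolding image T by (simp add: subtopology_subtopology)
  have rep: "affine_rep (proj_point (\<phi> u)) = \<phi> u" for u
    by (simp add: affine_rep_proj_point monic)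
  have "homeomorphic_maps (top_of_set U) (subtopology T ((proj_point \<circ> \<phi>) ` U))
      (proj_point \<circ> \<phi>) (h \<circ> affine_rep)"
    unfolding homeomorphic_maps_def
  proof (intro conjI)
    have "continuous_on U \<phi>"
      by (rule continuous_on_polymonial_function[OF poly])
    then have "continuous_map (top_of_set U) (top_of_set (- {0})) \<phi>"
      using nz by auto
    then have "continuous_map (top_of_set U) proj_topology (proj_point \<circ> \<phi>)"
      using continuous_map_proj_point continuous_map_compose by blast
    then show "continuous_map (top_of_set U) (subtopology T ((proj_point \<circ> \<phi>) ` U)) (proj_point \<circ> \<phi>)"
      unfolding T_image using image by (auto simp: continuous_map_in_subtopology)
    have "continuous_map (subtopology proj_topology (S \<inter> affine_part)) euclidean affine_rep"
      using continuous_map_affine_rep continuous_map_from_subtopology_mono by blast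
    moreover have "affine_rep p \<in> \<phi> ` U" if "p \<in> S \<inter> affine_part" for p
      using that rep unfolding image[symmetric] by auto
    ultimately have "continuous_map (subtopology proj_topology (S \<inter> affine_part)) (top_of_set (\<phi> ` U)) affine_rep"
      by (auto simp: continuous_map_in_subtopology)
    moreover have "continuous_map (top_of_set (\<phi> ` U)) (top_of_set U) h"
      using cont left_inv by auto
    ultimately show "continuous_map (subtopology T ((proj_point \<circ> \<phi>) ` U)) (top_of_set U) (h \<circ> affine_rep)"
      unfolding T_image by (rule continuous_map_compose)
  qed (use left_inv rep in auto)
  then have "homeomorphic_map (top_of_set U) (subtopology T ((proj_point \<circ> \<phi>) ` U)) (proj_point \<circ> \<phi>)"
    by (metis homeomorphic_maps_map)
  then show ?thesis
    using imm open_image by (simp add: local_param_def T_def)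
qed

section \<open>Transport along the group action\<close>

text \<open>Existence is carried over by h, the dimension bound is pulled back by its inverse
  g.\<close>

lemma max_quot_dim_image:
  fixes h :: "'v::euclidean_space \<Rightarrow> 'v"
  assumes "linear h" "linear g" "\<And>v. g (h v) = v" "\<And>v. h (g v) = v" "\<And>v. P (h v) \<longleftrightarrow> P v"
    and "max_quot_dim P W K n"
  shows "max_quot_dim P (h ` W) (h ` K) n"
proof -
  have inj: "inj h" "inj g"
    using assms(3,4) by (metis injI)+
  have dimh: "dim (h ` X) = dim X" and dimg: "dim (g ` X) = dim X" for X
    using inj assms(1,2) by (simp_all add: dim_image_eq inj_on_subset)
  obtain L where L: "subspace L" "K \<subseteq> L" "L \<subseteq> W" "\<forall>v\<in>L - K. P v" "dim L = dim K + n"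
    and max: "\<And>L. subspace L \<Longrightarrow> K \<subseteq> L \<Longrightarrow> L \<subseteq> W \<Longrightarrow> \<forall>v\<in>L - K. P v \<Longrightarrow> dim L \<le> dim K + n"
    using assms(6) unfolding max_quot_dim_def by blast
  show ?thesis
    unfolding max_quot_dim_def
  proof (intro conjI exI[of _ "h ` L"] allI impI)
    show "subspace (h ` L)" "h ` K \<subseteq> h ` L" "h ` L \<subseteq> h ` W" "dim (h ` L) = dim (h ` K) + n"
      using L assms(1) dimh by (auto simp: linear_subspace_image)
    show "\<forall>v\<in>h ` L - h ` K. P v"
      using L(4) assms(5) by blast
  next
    fix M assume M: "subspace M \<and> h ` K \<subseteq> M \<and> M \<subseteq> h ` W \<and> (\<forall>v\<in>M - h ` K. P v)"
    have "subspace (g ` M)"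
      using M assms(2) by (simp add: linear_subspace_image)
    moreover have "K \<subseteq> g ` M"
      using M assms(3) by (metis image_eqI image_subset_iff subsetI)
    moreover have "g ` M \<subseteq> W"
      using M assms(3) by force
    moreover have "P (g m)" if "m \<in> M" "g m \<notin> K" for m
      using M that assms(4,5) by (metis DiffI assms(3) imageE)
    ultimately have "dim (g ` M) \<le> dim K + n"
      by (intro max) auto
    then show "dim M \<le> dim (h ` K) + n"
      by (simp add: dimh dimg)
  qed
qed

lemma quot_signature_image:
  fixes h :: "'v::euclidean_space \<Rightarrow> 'v"
  assumes "linear h" "linear g" "\<And>v. g (h v) = v" "\<And>v. h (g v) = v" "\<And>v. Q (h v) = Q v"
    and "quot_signature Q W K sig"
  shows "quot_signature Q (h ` W) (h ` K) sig"
proof -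
  obtain p q r where sig: "sig = (p, q, r)"
    using prod_cases3 by blast
  have polar: "polar_form Q (h v) (h w) = polar_form Q v w" for v w
    by (simp add: polar_form_def assms(5) flip: linear_add[OF assms(1)])
  have inj: "inj h"
    using assms(3) by (metis injI)
  have dimh: "dim (h ` X) = dim X" for X
    using inj assms(1) by (simp add: dim_image_eq inj_on_subset)
  have "{v \<in> h ` W. \<forall>w\<in>h ` W. polar_form Q v w = 0} = h ` {v \<in> W. \<forall>w\<in>W. polar_form Q v w = 0}"
    using polar by auto
  then show ?thesis
    using assms(6) max_quot_dim_image[OF assms(1-4), of "\<lambda>v. Q v < 0"]
      max_quot_dim_image[OF assms(1-4), of "\<lambda>v. Q v > 0"]
    by (simp add: quot_signature_def sig dimh assms(5))
qed

lemma continuous_map_image_proj_topology: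
  assumes "linear h" "\<And>f. f \<noteq> 0 \<Longrightarrow> h f \<noteq> 0"
  shows "continuous_map proj_topology proj_topology (\<lambda>p. h ` p)"
proof -
  have im: "h ` proj_point f = proj_point (h f)" for f
    by (simp add: proj_point_def linear_span_image[OF assms(1), symmetric])
  have "openin proj_topology {p \<in> proj_space. h ` p \<in> V}" if V: "openin proj_topology V" for V
  proof -
    have "{f. f \<noteq> 0 \<and> proj_point f \<in> {p \<in> proj_space. h ` p \<in> V}} =
        - {0} \<inter> h -` {f. f \<noteq> 0 \<and> proj_point f \<in> V}"
      using assms(2) by (auto simp: proj_space_def im)
    moreover have "open \<dots>"
      using V assms(1) by (intro open_Int open_vimage linear_continuous_on)
        (auto simp: openin_proj_topology linear_conv_bounded_linear open_Compl)
    ultimately show ?thesis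
      by (auto simp: openin_proj_topology)
  qed
  moreover have "h ` p \<in> proj_space" if "p \<in> proj_space" for p
    using that assms(2) unfolding proj_space_def by (auto simp: im intro!: imageI)
  ultimately show ?thesis
    by (simp add: continuous_map_def topspace_proj_topology)
qed

lemma quartic_act_nonzero:
  assumes "det A = 1" "f \<noteq> 0"
  shows "quartic_act A f \<noteq> 0"
  using assms quartic_act_inverse linear_0[OF linear_quartic_act] by metis

lemma homeomorphic_map_quartic_act:
  assumes A: "det A = 1"
    and S: "S \<subseteq> proj_space" "\<And>B p. det B = 1 \<Longrightarrow> p \<in> S \<Longrightarrow> quartic_act B ` p \<in> S"
  shows "homeomorphic_map (subtopology proj_topology S) (subtopology proj_topology S) (\<lambda>p. quartic_act A ` p)"
proof -
  have cont: "continuous_map (subtopology proj_topology S) (subtopology proj_topology S) (\<lambda>p. quartic_act B ` p)"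
    if "det B = 1" for B
    using S(2)[OF that] continuous_map_image_proj_topology[OF linear_quartic_act quartic_act_nonzero[OF that]]
    by (auto simp: continuous_map_in_subtopology continuous_map_from_subtopology)
  have "quartic_act (matrix_inv A) ` quartic_act A ` p = p" "quartic_act A ` quartic_act (matrix_inv A) ` p = p" for p
    using A SL2_matrix_inv[OF A] by (simp_all add: image_image flip: quartic_act_mult)
  then have "homeomorphic_maps (subtopology proj_topology S) (subtopology proj_topology S)
      (\<lambda>p. quartic_act A ` p) (\<lambda>p. quartic_act (matrix_inv A) ` p)"
    unfolding homeomorphic_maps_def using cont A SL2_matrix_inv(3)[OF A] by simp
  then show ?thesis
    by (metis homeomorphic_maps_map)
qed

lemma bounded_linear_quartic_act: "bounded_linear (quartic_act A)"
  using linear_quartic_act by (simp only: linear_conv_bounded_linear)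

lemma frechet_derivative_quartic_act:
  assumes "\<phi> differentiable (at u)"
  shows "frechet_derivative (quartic_act A \<circ> \<phi>) (at u) = quartic_act A \<circ> frechet_derivative \<phi> (at u)"
proof -
  have "((\<lambda>x. quartic_act A (\<phi> x)) has_derivative (\<lambda>w. quartic_act A (frechet_derivative \<phi> (at u) w))) (at u)"
    using assms unfolding frechet_derivative_works
    by (rule bounded_linear.has_derivative[OF bounded_linear_quartic_act])
  then show ?thesis
    unfolding o_def by (rule frechet_derivative_at[symmetric])
qed

text \<open>The composite may leave the chart a_4 = 1, out of reach of
  \<open>local_param_affine\<close>; each property is instead transported by the homeomorphism that
  A induces on S.\<close>

lemma local_param_quartic_act:
  fixes \<phi> :: "real ^ 'n \<Rightarrow> quartic"
  assumes A: "det A = 1"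
    and S: "S \<subseteq> Ein" "\<And>B p. det B = 1 \<Longrightarrow> p \<in> S \<Longrightarrow> quartic_act B ` p \<in> S"
    and poly: "polynomial_function \<phi>" and param: "local_param (subtopology Ein_topology S) U \<phi>"
  shows "local_param (subtopology Ein_topology S) U (quartic_act A \<circ> \<phi>)"
proof -
  define T where "T = subtopology Ein_topology S"
  define P where "P = (proj_point \<circ> \<phi>) ` U"
  have T: "T = subtopology proj_topology S"
    using S by (simp add: T_def Ein_topology_def subtopology_subtopology inf.absorb2)
  have imm: "Ein_immersion U \<phi>" and P: "openin T P" and homeo: "homeomorphic_map (top_of_set U) (subtopology T P) (proj_point \<circ> \<phi>)"
    using param by (auto simp: local_param_def T_def P_def)
  have "S \<subseteq> proj_space"
    using S by (auto simp: Ein_def proj_space_def)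
  then have act: "homeomorphic_map T T (\<lambda>p. quartic_act A ` p)"
    unfolding T using homeomorphic_map_quartic_act A S by blast
  have comp: "proj_point \<circ> (quartic_act A \<circ> \<phi>) = (\<lambda>p. quartic_act A ` p) \<circ> (proj_point \<circ> \<phi>)"
    by (simp add: fun_eq_iff quartic_act_proj_point)
  then have image: "(proj_point \<circ> (quartic_act A \<circ> \<phi>)) ` U = (\<lambda>p. quartic_act A ` p) ` P"
    by (simp add: P_def image_comp)
  have "w = 0" if "u \<in> U" and
    span: "frechet_derivative (quartic_act A \<circ> \<phi>) (at u) w \<in> span {(quartic_act A \<circ> \<phi>) u}" for u w
  proof -
    have "quartic_act A (frechet_derivative \<phi> (at u) w) \<in> quartic_act A ` span {\<phi> u}"
      using span differentiable_at_polynomial_function[OF poly]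
      by (simp add: frechet_derivative_quartic_act linear_span_image[OF linear_quartic_act, symmetric])
    then have "frechet_derivative \<phi> (at u) w \<in> span {\<phi> u}"
      using quartic_act_inverse[OF A] by (metis imageE)
    then show ?thesis
      using imm \<open>u \<in> U\<close> by (simp add: Ein_immersion_def)
  qed
  moreover have "polynomial_function (quartic_act A \<circ> \<phi>)"
    by (rule polynomial_function_compose[OF poly
          polynomial_function_bounded_linear[OF bounded_linear_quartic_act]])
  ultimately have "Ein_immersion U (quartic_act A \<circ> \<phi>)"
    using imm A quartic_act_nonzero[OF A]
    by (simp add: Ein_immersion_def polynomial_function_smooth_on qform_act)
  moreover have "openin T ((\<lambda>p. quartic_act A ` p) ` P)"
    using act P by (metis homeomorphic_map_openness openin_subset)
  moreover have "homeomorphic_map (subtopology T P) (subtopology T ((\<lambda>p. quartic_act A ` p) ` P)) (\<lambda>p. quartic_act A ` p)"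
    using act openin_subset[OF P] homeomorphic_imp_surjective_map[OF act]
    by (intro homeomorphic_map_subtopologies) auto
  then have "homeomorphic_map (top_of_set U) (subtopology T ((\<lambda>p. quartic_act A ` p) ` P))
      ((\<lambda>p. quartic_act A ` p) \<circ> (proj_point \<circ> \<phi>))"
    using homeo homeomorphic_map_compose by blast
  ultimately show ?thesis
    unfolding local_param_def T_def[symmetric] image unfolding comp by blast
qed

text \<open>Every point is reached from the single point \<open>\<phi> u\<close> by some A.
  Composing with A keeps the parameter u and maps the lifted tangent space by an isometry of
  \<open>qform\<close>, so the signature is the same everywhere.\<close>

lemma immersed_orbit:
  fixes \<phi> :: "real ^ 'n \<Rightarrow> quartic"
  assumes S: "S \<subseteq> Ein" "\<And>B p. det B = 1 \<Longrightarrow> p \<in> S \<Longrightarrow> quartic_act B ` p \<in> S"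
    and trans: "\<And>p. p \<in> S \<Longrightarrow> \<exists>A. det A = 1 \<and> p = quartic_act A ` proj_point (\<phi> u)"
    and poly: "polynomial_function \<phi>" and param: "local_param (subtopology Ein_topology S) U \<phi>"
    and u: "u \<in> U" and sig: "quot_signature qform (lifted_tangent_space \<phi> u) (span {\<phi> u}) sig"
  shows "immersed_submanifold_with_signature TYPE(real ^ 'n) S sig"
  unfolding immersed_submanifold_with_signature_def
proof (intro conjI exI[of _ "subtopology Ein_topology S"] ballI)
  show "S \<subseteq> Ein"
    by fact
  have T: "subtopology Ein_topology S = subtopology proj_topology S"
    using S by (simp add: Ein_topology_def subtopology_subtopology inf.absorb2)
  have "S \<subseteq> proj_space"
    using S by (auto simp: Ein_def proj_space_def)
  then show "topspace (subtopology Ein_topology S) = S"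
    by (auto simp: T topspace_proj_topology)
  show "second_countable (subtopology Ein_topology S)"
    unfolding T by (intro second_countable_subtopology second_countable_proj_topology)
  show "continuous_map (subtopology Ein_topology S) Ein_topology id"
    by (simp add: continuous_map_from_subtopology)
  fix p assume "p \<in> S"
  then obtain A where A: "det A = 1" "p = quartic_act A ` proj_point (\<phi> u)"
    using trans by blast
  have lin: "quartic_act A (c *\<^sub>R f + g) = c *\<^sub>R quartic_act A f + quartic_act A g" for c f g
    by (simp add: linear_add[OF linear_quartic_act] linear_scale[OF linear_quartic_act])
  have W: "lifted_tangent_space (quartic_act A \<circ> \<phi>) u = quartic_act A ` lifted_tangent_space \<phi> u"
    unfolding lifted_tangent_space_def o_apply lin[symmetric]
      frechet_derivative_quartic_act[OF differentiable_at_polynomial_function[OF poly]]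
    by blast
  have K: "span {(quartic_act A \<circ> \<phi>) u} = quartic_act A ` span {\<phi> u}"
    by (simp add: linear_span_image[OF linear_quartic_act, symmetric])
  have "quot_signature qform (lifted_tangent_space (quartic_act A \<circ> \<phi>) u) (span {(quartic_act A \<circ> \<phi>) u}) sig"
    unfolding W K
    by (rule quot_signature_image[OF linear_quartic_act linear_quartic_act[of "matrix_inv A"]])
      (use A sig SL2_matrix_inv[OF A(1)] in \<open>simp_all add: qform_act flip: quartic_act_mult\<close>)
  then show "\<exists>(U :: (real ^ 'n) set) \<phi> u. local_param (subtopology Ein_topology S) U \<phi> \<and> u \<in> U \<and>
      p = proj_point (\<phi> u) \<and> quot_signature qform (lifted_tangent_space \<phi> u) (span {\<phi> u}) sig"
    using local_param_quartic_act[OF A(1) S poly param] u A(2)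
    by (intro exI[of _ U] exI[of _ "quartic_act A \<circ> \<phi>"] exI[of _ u]) (simp add: quartic_act_proj_point)
qed

section \<open>Signatures\<close>

text \<open>The witness N bounds all competitors M: on N the property fails off K, so M and N meet
  inside K, and the dimension formula gives dim M \<le> dim W + dim K - dim N.\<close>

lemma max_quot_dimI:
  assumes "subspace L" "K \<subseteq> L" "L \<subseteq> W" "\<And>v. v \<in> L - K \<Longrightarrow> P v" "dim L = dim K + n"
    and "subspace W" "subspace N" "N \<subseteq> W" "\<And>v. v \<in> N - K \<Longrightarrow> \<not> P v" "dim N + n = dim W"
  shows "max_quot_dim P W K n"
  unfolding max_quot_dim_def
proof (intro conjI exI[of _ L] allI impI)
  fix M assume M: "subspace M \<and> K \<subseteq> M \<and> M \<subseteq> W \<and> (\<forall>v\<in>M - K. P v)"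
  have "M \<inter> N \<subseteq> K"
    using M assms(9) by blast
  then have "dim (M \<inter> N) \<le> dim K"
    by (rule dim_subset)
  moreover have "{x + y |x y. x \<in> M \<and> y \<in> N} \<subseteq> W"
    using M assms(6,8) by (auto intro: subspace_add)
  then have "dim {x + y |x y. x \<in> M \<and> y \<in> N} \<le> dim W"
    by (rule dim_subset)
  moreover have "dim {x + y |x y. x \<in> M \<and> y \<in> N} + dim (M \<inter> N) = dim M + dim N"
    using M assms(7) by (intro dim_sums_Int) auto
  ultimately show "dim M \<le> dim K + n"
    using assms(10) by linarith
qed (use assms in auto)

lemma subspace_dim_quartics_2:
  fixes f :: "real \<Rightarrow> real \<Rightarrow> quartic"
  assumes "linear (\<lambda>x :: real ^ 2. f (x $ 1) (x $ 2))" "\<And>a b. f a b = 0 \<Longrightarrow> a = 0 \<and> b = 0"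
  shows "subspace {f a b |a b. True} \<and> dim {f a b |a b. True} = 2"
proof -
  have "f a b \<in> range (\<lambda>x :: real ^ 2. f (x $ 1) (x $ 2))" for a b
    by (rule range_eqI[of _ _ "vector [a, b]"]) simp
  then have *: "{f a b |a b. True} = range (\<lambda>x :: real ^ 2. f (x $ 1) (x $ 2))"
    by auto
  have "x = 0" if "f (x $ 1) (x $ 2) = 0" for x :: "real ^ 2"
    using assms(2)[OF that] by (simp add: vec_eq_iff forall_2)
  then have "inj (\<lambda>x :: real ^ 2. f (x $ 1) (x $ 2))"
    unfolding linear_injective_0[OF assms(1)] by blast
  then show ?thesis
    unfolding * using assms(1) by (simp add: linear_subspace_image dim_image_eq)
qed

lemma subspace_dim_quartics_3:
  fixes f :: "real \<Rightarrow> real \<Rightarrow> real \<Rightarrow> quartic"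
  assumes "linear (\<lambda>x :: real ^ 3. f (x $ 1) (x $ 2) (x $ 3))"
    "\<And>a b c. f a b c = 0 \<Longrightarrow> a = 0 \<and> b = 0 \<and> c = 0"
  shows "subspace {f a b c |a b c. True} \<and> dim {f a b c |a b c. True} = 3"
proof -
  have "f a b c \<in> range (\<lambda>x :: real ^ 3. f (x $ 1) (x $ 2) (x $ 3))" for a b c
    by (rule range_eqI[of _ _ "vector [a, b, c]"]) simp
  then have *: "{f a b c |a b c. True} = range (\<lambda>x :: real ^ 3. f (x $ 1) (x $ 2) (x $ 3))"
    by auto
  have "x = 0" if "f (x $ 1) (x $ 2) (x $ 3) = 0" for x :: "real ^ 3"
    using assms(2)[OF that] by (simp add: vec_eq_iff forall_3)
  then have "inj (\<lambda>x :: real ^ 3. f (x $ 1) (x $ 2) (x $ 3))"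
    unfolding linear_injective_0[OF assms(1)] by blast
  then show ?thesis
    unfolding * using assms(1) by (simp add: linear_subspace_image dim_image_eq)
qed

lemma subspace_dim_quartics_4:
  fixes f :: "real \<Rightarrow> real \<Rightarrow> real \<Rightarrow> real \<Rightarrow> quartic"
  assumes "linear (\<lambda>x :: real ^ 4. f (x $ 1) (x $ 2) (x $ 3) (x $ 4))"
    "\<And>a b c d. f a b c d = 0 \<Longrightarrow> a = 0 \<and> b = 0 \<and> c = 0 \<and> d = 0"
  shows "subspace {f a b c d |a b c d. True} \<and> dim {f a b c d |a b c d. True} = 4"
proof -
  have "f a b c d \<in> range (\<lambda>x :: real ^ 4. f (x $ 1) (x $ 2) (x $ 3) (x $ 4))" for a b c d
    by (rule range_eqI[of _ _ "\<chi> i. if i = 1 then a else if i = 2 then b else if i = 3 then c else d"]) simp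
  then have *: "{f a b c d |a b c d. True} = range (\<lambda>x :: real ^ 4. f (x $ 1) (x $ 2) (x $ 3) (x $ 4))"
    by auto
  have "x = 0" if "f (x $ 1) (x $ 2) (x $ 3) (x $ 4) = 0" for x :: "real ^ 4"
    using assms(2)[OF that] by (simp add: vec_eq_iff forall_4)
  then have "inj (\<lambda>x :: real ^ 4. f (x $ 1) (x $ 2) (x $ 3) (x $ 4))"
    unfolding linear_injective_0[OF assms(1)] by blast
  then show ?thesis
    unfolding * using assms(1) by (simp add: linear_subspace_image dim_image_eq)
qed

lemma polar_form_qform:
  "polar_form qform f g = f $ 4 * g $ 0 + f $ 0 * g $ 4 - (f $ 1 * g $ 3 + f $ 3 * g $ 1) / 4 + f $ 2 * g $ 2 / 6"
  by (simp add: polar_form_def qform_def power2_eq_square field_simps)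

section \<open>The induced forms at one point of each orbit\<close>

text \<open>The multiples of X^3 form a totally isotropic plane.\<close>

lemma tangent_signature_X4:
  "quot_signature qform {mk_quartic x y 0 0 0 |x y. True} (span {X4}) (0, 0, 1)"
proof -
  define W where "W = {mk_quartic x y 0 0 0 |x y. True}"
  define K where "K = span {X4}"
  have W: "subspace W" "dim W = 2"
    using subspace_dim_quartics_2[of "\<lambda>x y. mk_quartic x y 0 0 0"]
    by (auto simp: W_def linear_iff quartic_eq_iff)
  have "X4 \<noteq> 0"
    by (simp add: quartic_eq_iff)
  then have K: "subspace K" "dim K = 1"
    by (simp_all add: K_def)
  have KW: "K \<subseteq> W"
    unfolding K_def using W(1) by (intro span_minimal) (auto simp: W_def)
  have q: "qform v = 0" if "v \<in> W" for v
    using that by (auto simp: W_def qform_def)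
  have "max_quot_dim (\<lambda>v. qform v < 0) W K 0" "max_quot_dim (\<lambda>v. qform v > 0) W K 0"
    by (rule max_quot_dimI[of K _ _ _ _ W]; use W K KW q in simp)+
  moreover have "{v \<in> W. \<forall>w\<in>W. polar_form qform v w = 0} = W"
    by (auto simp: W_def polar_form_qform)
  ultimately show ?thesis
    unfolding W_def[symmetric] K_def[symmetric] quot_signature_def using W K by simp
qed

text \<open>On the multiples of X^2 the form is a_2^2 / 6, with radical a_2 = 0. The base point is
  X^3 (X + Y), since X^3 Y lies outside the chart a_4 = 1.\<close>

lemma tangent_signature_X3Y:
  "quot_signature qform {mk_quartic x y z 0 0 |x y z. True} (span {mk_quartic 1 1 0 0 0}) (0, 1, 1)"
proof -
  define W where "W = {mk_quartic x y z 0 0 |x y z. True}"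
  define R where "R = {mk_quartic x y 0 0 0 |x y. True}"
  define P where "P = {mk_quartic x x z 0 0 |x z. True}"
  define K where "K = span {mk_quartic 1 1 0 0 0}"
  have W: "subspace W" "dim W = 3"
    using subspace_dim_quartics_3[of "\<lambda>x y z. mk_quartic x y z 0 0"]
    by (auto simp: W_def linear_iff quartic_eq_iff)
  have R: "subspace R" "dim R = 2"
    using subspace_dim_quartics_2[of "\<lambda>x y. mk_quartic x y 0 0 0"]
    by (auto simp: R_def linear_iff quartic_eq_iff)
  have P: "subspace P" "dim P = 2"
    using subspace_dim_quartics_2[of "\<lambda>x z. mk_quartic x x z 0 0"]
    by (auto simp: P_def linear_iff quartic_eq_iff)
  have "mk_quartic 1 1 0 0 0 \<noteq> 0"
    by (simp add: quartic_eq_iff)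
  then have K: "subspace K" "dim K = 1"
    by (simp_all add: K_def)
  have KP: "K \<subseteq> P"
    unfolding K_def using P(1) by (intro span_minimal) (auto simp: P_def)
  have PW: "P \<subseteq> W" and RW: "R \<subseteq> W"
    by (auto simp: P_def R_def W_def)
  have qW: "qform v \<ge> 0" if "v \<in> W" for v
    using that by (auto simp: W_def qform_def)
  have qR: "qform v = 0" if "v \<in> R" for v
    using that by (auto simp: R_def qform_def)
  have qP: "qform v > 0" if v: "v \<in> P - K" for v
  proof -
    obtain x z where xz: "v = mk_quartic x x z 0 0"
      using v by (auto simp: P_def)
    have "z \<noteq> 0"
    proof
      assume "z = 0"
      then have "v = x *\<^sub>R mk_quartic 1 1 0 0 0"
        by (simp add: xz quartic_eq_iff)
      then show False
        using v by (auto simp: K_def span_singleton)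
    qed
    then show ?thesis
      by (simp add: xz qform_def)
  qed
  have "max_quot_dim (\<lambda>v. qform v < 0) W K 0"
    by (rule max_quot_dimI[of K _ _ _ _ W]; use W K KP PW qW in \<open>auto simp: not_less\<close>)
  moreover have "max_quot_dim (\<lambda>v. qform v > 0) W K 1"
    by (rule max_quot_dimI[of P _ _ _ _ R]; use W K R P KP PW RW qP qR in auto)
  moreover have "{v \<in> W. \<forall>w\<in>W. polar_form qform v w = 0} = R"
  proof (intro equalityI subsetI)
    fix v assume v: "v \<in> {v \<in> W. \<forall>w\<in>W. polar_form qform v w = 0}"
    then obtain x y z where xyz: "v = mk_quartic x y z 0 0"
      by (auto simp: W_def)
    have "mk_quartic 0 0 1 0 0 \<in> W"
      unfolding W_def by blast
    then have "polar_form qform v (mk_quartic 0 0 1 0 0) = 0"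
      using v by blast
    then have "z = 0"
      by (simp add: xyz polar_form_qform)
    then show "v \<in> R"
      unfolding R_def xyz by blast
  qed (auto simp: W_def R_def polar_form_qform)
  ultimately show ?thesis
    unfolding W_def[symmetric] K_def[symmetric] quot_signature_def using R K by simp
qed

text \<open>W is the orthogonal complement of the base point; on it the form is y (x - w) / 2 + z^2
  / 6. The choices w = x - y and w = x + y split the hyperbolic part, and P and N bound each other's
  dimension.\<close>

lemma tangent_signature_X4XY3:
  "quot_signature qform {mk_quartic x y z w (y / 4) |x y z w. True} (span {X4XY3}) (1, 2, 0)"
proof -
  define W where "W = {mk_quartic x y z w (y / 4) |x y z w. True}"
  define P where "P = {mk_quartic x y z (x - y) (y / 4) |x y z. True}"
  define N where "N = {mk_quartic x y 0 (x + y) (y / 4) |x y. True}"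
  define K where "K = span {X4XY3}"
  have W: "subspace W" "dim W = 4"
    using subspace_dim_quartics_4[of "\<lambda>x y z w. mk_quartic x y z w (y / 4)"]
    by (auto simp: W_def linear_iff quartic_eq_iff)
  have P: "subspace P" "dim P = 3"
    using subspace_dim_quartics_3[of "\<lambda>x y z. mk_quartic x y z (x - y) (y / 4)"]
    by (auto simp: P_def linear_iff quartic_eq_iff algebra_simps)
  have N: "subspace N" "dim N = 2"
    using subspace_dim_quartics_2[of "\<lambda>x y. mk_quartic x y 0 (x + y) (y / 4)"]
    by (auto simp: N_def linear_iff quartic_eq_iff algebra_simps)
  have "X4XY3 \<noteq> 0"
    by (simp add: quartic_eq_iff)
  then have K: "subspace K" "dim K = 1"
    by (simp_all add: K_def)
  have "X4XY3 \<in> P"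
    unfolding P_def by (rule CollectI, rule exI[of _ 1], rule exI[of _ 0], rule exI[of _ 0]) simp
  then have KP: "K \<subseteq> P"
    unfolding K_def using P(1) by (intro span_minimal) auto
  have "X4XY3 \<in> N"
    unfolding N_def by (rule CollectI, rule exI[of _ 1], rule exI[of _ 0]) simp
  then have KN: "K \<subseteq> N"
    unfolding K_def using N(1) by (intro span_minimal) auto
  have PW: "P \<subseteq> W" and NW: "N \<subseteq> W"
    by (auto simp: P_def N_def W_def)
  have memK: "mk_quartic x 0 0 x 0 \<in> K" for x
  proof -
    have "mk_quartic x 0 0 x 0 = x *\<^sub>R X4XY3"
      by (simp add: quartic_eq_iff)
    then show ?thesis
      by (simp add: K_def span_base span_scale)
  qed
  have memW: "f \<in> W" if "f $ 0 = f $ 3 / 4" for f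
  proof -
    have "f = mk_quartic (f $ 4) (f $ 3) (f $ 2) (f $ 1) (f $ 3 / 4)"
      using that by (simp add: quartic_eq_iff)
    then show ?thesis
      unfolding W_def by blast
  qed
  have qP: "qform v > 0" if v: "v \<in> P - K" for v
  proof -
    obtain x y z where xyz: "v = mk_quartic x y z (x - y) (y / 4)"
      using v by (auto simp: P_def)
    have "y \<noteq> 0 \<or> z \<noteq> 0"
      using v memK[of x] by (auto simp: xyz)
    moreover have "qform v = y\<^sup>2 / 2 + z\<^sup>2 / 6"
      by (simp add: xyz qform_def power2_eq_square field_simps)
    ultimately show ?thesis
      by (auto simp: add_pos_nonneg add_nonneg_pos)
  qed
  have qN: "qform v < 0" if v: "v \<in> N - K" for v
  proof -
    obtain x y where xy: "v = mk_quartic x y 0 (x + y) (y / 4)"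
      using v by (auto simp: N_def)
    have "y \<noteq> 0"
      using v memK[of x] by (auto simp: xy)
    moreover have "qform v = - (y\<^sup>2 / 2)"
      by (simp add: xy qform_def power2_eq_square field_simps)
    ultimately show ?thesis
      by simp
  qed
  have "max_quot_dim (\<lambda>v. qform v < 0) W K 1"
    by (rule max_quot_dimI[of N _ _ _ _ P]; use W K N P KP KN PW NW qP qN in \<open>auto simp: not_less less_imp_le\<close>)
  moreover have "max_quot_dim (\<lambda>v. qform v > 0) W K 2"
    by (rule max_quot_dimI[of P _ _ _ _ N]; use W K N P KP KN PW NW qP qN in \<open>auto simp: not_less less_imp_le\<close>)
  moreover have "{v \<in> W. \<forall>w\<in>W. polar_form qform v w = 0} = K"
  proof (intro equalityI subsetI)
    fix v assume v: "v \<in> {v \<in> W. \<forall>w\<in>W. polar_form qform v w = 0}"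
    then obtain x y z w where xyzw: "v = mk_quartic x y z w (y / 4)"
      by (auto simp: W_def)
    have "mk_quartic 0 1 0 0 (1 / 4) \<in> W" "mk_quartic 0 0 1 0 0 \<in> W" "mk_quartic 0 0 0 1 0 \<in> W"
      using memW by simp_all
    then have "polar_form qform v (mk_quartic 0 1 0 0 (1 / 4)) = 0"
      "polar_form qform v (mk_quartic 0 0 1 0 0) = 0" "polar_form qform v (mk_quartic 0 0 0 1 0) = 0"
      using v by blast+
    then have "y = 0" "z = 0" "w = x"
      by (simp_all add: xyzw polar_form_qform)
    then show "v \<in> K"
      using memK by (simp add: xyzw)
  next
    fix v assume "v \<in> K"
    then show "v \<in> {v \<in> W. \<forall>w\<in>W. polar_form qform v w = 0}"
      using KP PW by (auto simp: K_def span_singleton W_def polar_form_qform)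
  qed
  ultimately show ?thesis
    unfolding W_def[symmetric] K_def[symmetric] quot_signature_def using K by simp
qed

section \<open>The three orbits\<close>

text \<open>Invariance and transitivity hold for any orbit; the point \<open>\<phi> u\<close> may
  differ from the base point f as long as it generates the same orbit.\<close>

lemma immersed_proj_orbit:
  fixes \<phi> :: "real ^ 'n \<Rightarrow> quartic"
  assumes f: "f \<noteq> 0" "qform f = 0" and poly: "polynomial_function \<phi>"
    and param: "local_param (subtopology Ein_topology (proj_orbit f)) U \<phi>" and u: "u \<in> U"
    and sig: "quot_signature qform (lifted_tangent_space \<phi> u) (span {\<phi> u}) sig"
  shows "immersed_submanifold_with_signature TYPE(real ^ 'n) (proj_orbit f) sig"
proof (rule immersed_orbit[OF _ _ _ poly param u sig])
  have T: "topspace (subtopology Ein_topology (proj_orbit f)) \<subseteq> proj_orbit f"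
    by simp
  show "proj_orbit f \<subseteq> Ein"
    by (rule proj_orbit_subset_Ein[OF f])
  show "quartic_act B ` p \<in> proj_orbit f" if "det B = 1" "p \<in> proj_orbit f" for B p
  proof -
    obtain M where "p = proj_point (subst_quartic M f)" "det M > 0"
      using \<open>p \<in> proj_orbit f\<close> by (auto simp: proj_orbit_def)
    then have "quartic_act B ` p = proj_point (subst_quartic (matrix_inv B) (subst_quartic M f))"
      by (simp add: quartic_act_proj_point) (simp add: quartic_act_eq_subst)
    then show ?thesis
      using that SL2_matrix_inv(3)[of B] \<open>p = proj_point (subst_quartic M f)\<close>
      by (simp add: subst_mem_proj_orbit_iff)
  qed
  have "(proj_point \<circ> \<phi>) ` U \<subseteq> proj_orbit f"
    using param T openin_subset unfolding local_param_def by blast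
  then have "proj_orbit (\<phi> u) = proj_orbit f"
    using u by (intro proj_orbit_eq) auto
  then show "\<exists>A. det A = 1 \<and> p = quartic_act A ` proj_point (\<phi> u)" if "p \<in> proj_orbit f" for p
    using that unfolding proj_orbit_SL2[of "\<phi> u", symmetric]
    by (auto simp: proj_orbit_SL2[of "\<phi> u"] quartic_act_proj_point)
qed

lemma has_derivative_nth [derivative_intros]:
  "((\<lambda>x :: real ^ 'n. x $ i) has_derivative (\<lambda>w. w $ i)) F"
  by (rule bounded_linear_imp_has_derivative[OF bounded_linear_vec_nth])

lemma immersed_orbit_X4:
  "immersed_submanifold_with_signature TYPE(real ^ 1) (proj_orbit X4) (0, 0, 1)"
proof -
  \<comment> \<open>The rational normal curve of the (X + t Y)^4, from which only the point of Y^4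
    is missing.\<close>
  define \<phi> :: "real ^ 1 \<Rightarrow> quartic" where
    "\<phi> = (\<lambda>u. mk_quartic 1 (4 * u $ 1) (6 * (u $ 1)\<^sup>2) (4 * (u $ 1) ^ 3) ((u $ 1) ^ 4))"
  have null: "X4 \<noteq> 0" "qform X4 = 0"
    by (auto simp: quartic_eq_iff qform_def)
  have poly: "polynomial_function \<phi>"
    unfolding \<phi>_def by (intro polynomial_function_mk_quartic real_polynomial_function.intros(2-4)
        real_polynomial_function_power real_polynomial_function_nth)
  have deriv: "frechet_derivative \<phi> (at u) = (\<lambda>w. mk_quartic 0 (4 * w $ 1) (12 * u $ 1 * w $ 1)
      (12 * (u $ 1)\<^sup>2 * w $ 1) (4 * (u $ 1) ^ 3 * w $ 1))" for u
    unfolding \<phi>_def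
    by (rule frechet_derivative_at[symmetric], rule has_derivative_mk_quartic)
      (auto intro!: derivative_eq_intros simp: fun_eq_iff)
  have at0: "\<phi> 0 = X4" "frechet_derivative \<phi> (at 0) = (\<lambda>w. mk_quartic 0 (4 * w $ 1) 0 0 0)"
    unfolding deriv by (simp_all add: \<phi>_def)
  have "local_param (subtopology Ein_topology (proj_orbit X4)) UNIV \<phi>"
  proof (rule local_param_affine[where h = "\<lambda>f. \<chi> i. f $ 3 / 4"])
    show "(proj_point \<circ> \<phi>) ` UNIV = proj_orbit X4 \<inter> affine_part"
    proof (intro equalityI subsetI)
      fix p assume "p \<in> (proj_point \<circ> \<phi>) ` UNIV"
      then show "p \<in> proj_orbit X4 \<inter> affine_part"
        using X4_orbitI by (force simp: \<phi>_def affine_part_def)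
    next
      fix p assume p: "p \<in> proj_orbit X4 \<inter> affine_part"
      then obtain M where M: "det M > 0" "p = proj_point (subst_quartic M X4)"
        by (auto simp: proj_orbit_def)
      define a b where "a = M $ 1 $ 1" "b = M $ 1 $ 2"
      have "subst_quartic M X4 $ 4 \<noteq> 0"
        using p M null by (simp add: proj_point_in_affine_part subst_quartic_eq_0_iff)
      then have "a \<noteq> 0"
        by (auto simp: subst_quartic_def Let_def a_b_def)
      then have "subst_quartic M X4 = a ^ 4 *\<^sub>R \<phi> (\<chi> i. b / a)"
        by (simp add: subst_quartic_def Let_def \<phi>_def quartic_eq_iff field_simps flip: a_b_def)
          (simp add: power4_eq_xxxx power3_eq_cube power2_eq_square)
      then show "p \<in> (proj_point \<circ> \<phi>) ` UNIV"
        using M \<open>a \<noteq> 0\<close> by (simp add: proj_point_scaleR)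
    qed
    show "continuous_on (\<phi> ` UNIV) (\<lambda>f. \<chi> i. f $ 3 / 4)"
      by (intro continuous_intros) auto
    show "w = 0" if "frechet_derivative \<phi> (at u) w = 0" for u w
      using that by (simp add: deriv quartic_eq_iff vec_eq_iff)
    show "qform (\<phi> u) = 0" for u
      by (simp add: \<phi>_def qform_def power2_eq_square power3_eq_cube power4_eq_xxxx)
  qed (use poly proj_orbit_subset_Ein[OF null] in \<open>auto simp: \<phi>_def vec_eq_iff\<close>)
  moreover have "lifted_tangent_space \<phi> 0 = {mk_quartic x y 0 0 0 |x y. True}"
  proof (intro equalityI subsetI)
    fix v assume "v \<in> {mk_quartic x y 0 0 0 |x y. True}"
    then obtain x y where "v = mk_quartic x y 0 0 0"
      by blast
    then have "v = x *\<^sub>R \<phi> 0 + frechet_derivative \<phi> (at 0) (\<chi> i. y / 4)"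
      by (simp add: quartic_eq_iff at0)
    then show "v \<in> lifted_tangent_space \<phi> 0"
      unfolding lifted_tangent_space_def by blast
  next
    fix v assume "v \<in> lifted_tangent_space \<phi> 0"
    then obtain c and w :: "real ^ 1" where "v = c *\<^sub>R X4 + mk_quartic 0 (4 * w $ 1) 0 0 0"
      unfolding lifted_tangent_space_def at0 by blast
    then have "v = mk_quartic c (4 * w $ 1) 0 0 0"
      by (simp add: quartic_eq_iff)
    then show "v \<in> {mk_quartic x y 0 0 0 |x y. True}"
      by blast
  qed
  ultimately show ?thesis
    using tangent_signature_X4 at0(1) by (intro immersed_proj_orbit[OF null poly, of UNIV 0]) auto
qed

lemma immersed_orbit_X3Y:
  "immersed_submanifold_with_signature TYPE(real ^ 2) (proj_orbit X3Y) (0, 1, 1)"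
proof -
  define \<phi> :: "real ^ 2 \<Rightarrow> quartic" where
    "\<phi> = (\<lambda>u. mk_quartic 1 (3 * u $ 1 + u $ 2) (3 * (u $ 1)\<^sup>2 + 3 * u $ 1 * u $ 2)
      ((u $ 1) ^ 3 + 3 * (u $ 1)\<^sup>2 * u $ 2) ((u $ 1) ^ 3 * u $ 2))"
  \<comment> \<open>The Hessian of (X + s Y)^3 (X + t Y) is a multiple of (X + s Y)^4; a quarter of
    the ratio of its first two coefficients recovers s. Numerator and denominator here are 3 s (t -
    s)^2 and 3 (t - s)^2.\<close>
  define s :: "quartic \<Rightarrow> real" where
    "s = (\<lambda>f. (f $ 3 * f $ 2 - 6 * f $ 1) / (3 * (f $ 3)\<^sup>2 - 8 * f $ 2))"
  \<comment> \<open>On the diagonal the image falls into the orbit of X^4 and the derivative loses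
    rank.\<close>
  define U :: "(real ^ 2) set" where "U = {u. u $ 1 \<noteq> u $ 2}"
  define u0 :: "real ^ 2" where "u0 = vector [0, 1]"
  have null: "X3Y \<noteq> 0" "qform X3Y = 0"
    by (auto simp: quartic_eq_iff qform_def)
  have poly: "polynomial_function \<phi>"
    unfolding \<phi>_def by (intro polynomial_function_mk_quartic real_polynomial_function.intros(2-4)
        real_polynomial_function_power real_polynomial_function_nth)
  have deriv: "frechet_derivative \<phi> (at u) = (\<lambda>w. mk_quartic 0 (3 * w $ 1 + w $ 2)
      (6 * u $ 1 * w $ 1 + 3 * u $ 1 * w $ 2 + 3 * u $ 2 * w $ 1)
      (3 * (u $ 1)\<^sup>2 * w $ 1 + 3 * (u $ 1)\<^sup>2 * w $ 2 + 6 * u $ 1 * u $ 2 * w $ 1)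
      ((u $ 1) ^ 3 * w $ 2 + 3 * (u $ 1)\<^sup>2 * u $ 2 * w $ 1))" for u
    unfolding \<phi>_def
    by (rule frechet_derivative_at[symmetric], rule has_derivative_mk_quartic)
      (auto intro!: derivative_eq_intros simp: fun_eq_iff algebra_simps)
  have disc: "3 * (\<phi> u $ 3)\<^sup>2 - 8 * \<phi> u $ 2 = 3 * (u $ 2 - u $ 1)\<^sup>2" for u
    by (simp add: \<phi>_def power2_eq_square algebra_simps)
  have disc_nz: "3 * (\<phi> u $ 3)\<^sup>2 - 8 * \<phi> u $ 2 \<noteq> 0" if "u \<in> U" for u
    unfolding disc using that by (simp add: U_def)
  have s: "s (\<phi> u) = u $ 1" if "u \<in> U" for u
  proof -
    have "\<phi> u $ 3 * \<phi> u $ 2 - 6 * \<phi> u $ 1 = 3 * (u $ 2 - u $ 1)\<^sup>2 * u $ 1"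
      by (simp add: \<phi>_def power2_eq_square power3_eq_cube algebra_simps)
    then show ?thesis
      using that by (simp add: s_def disc U_def)
  qed
  have at_u0: "\<phi> u0 = mk_quartic 1 1 0 0 0"
    "frechet_derivative \<phi> (at u0) = (\<lambda>w. mk_quartic 0 (3 * w $ 1 + w $ 2) (3 * w $ 1) 0 0)"
    unfolding deriv by (simp_all add: \<phi>_def u0_def)
  have "local_param (subtopology Ein_topology (proj_orbit X3Y)) U \<phi>"
  proof (rule local_param_affine[where h = "\<lambda>f. \<chi> i. if i = 1 then s f else f $ 3 - 3 * s f"])
    show "open U"
      unfolding U_def by (intro open_Collect_neq continuous_intros)
    show "(proj_point \<circ> \<phi>) ` U = proj_orbit X3Y \<inter> affine_part"
    proof (intro equalityI subsetI)
      fix p assume "p \<in> (proj_point \<circ> \<phi>) ` U"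
      then show "p \<in> proj_orbit X3Y \<inter> affine_part"
        using X3Y_orbitI by (force simp: \<phi>_def affine_part_def U_def)
    next
      fix p assume p: "p \<in> proj_orbit X3Y \<inter> affine_part"
      then obtain M where M: "det M > 0" "p = proj_point (subst_quartic M X3Y)"
        by (auto simp: proj_orbit_def)
      define a b c d where "a = M $ 1 $ 1" "b = M $ 1 $ 2" "c = M $ 2 $ 1" "d = M $ 2 $ 2"
      note abcd = this
      have "subst_quartic M X3Y $ 4 \<noteq> 0"
        using p M null by (simp add: proj_point_in_affine_part subst_quartic_eq_0_iff)
      then have nz: "a \<noteq> 0" "c \<noteq> 0"
        by (auto simp: subst_quartic_def Let_def abcd)
      define u :: "real ^ 2" where "u = vector [b / a, d / c]"
      have "subst_quartic M X3Y = (a ^ 3 * c) *\<^sub>R \<phi> u"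
        using nz by (simp add: subst_quartic_def Let_def \<phi>_def u_def quartic_eq_iff field_simps flip: abcd)
          (simp add: eval_nat_numeral algebra_simps)
      moreover have "u \<in> U"
        using nz M by (auto simp: U_def u_def det_2 field_simps simp flip: abcd)
      ultimately show "p \<in> (proj_point \<circ> \<phi>) ` U"
        using M nz by (auto simp: proj_point_scaleR)
    qed
    show "w = 0" if "u \<in> U" "frechet_derivative \<phi> (at u) w = 0" for u w
    proof -
      have w2: "w $ 2 = - 3 * w $ 1" and "6 * u $ 1 * w $ 1 + 3 * u $ 1 * w $ 2 + 3 * u $ 2 * w $ 1 = 0"
        using that(2) by (auto simp: deriv quartic_eq_iff)
      then have "3 * (u $ 2 - u $ 1) * w $ 1 = 0"
        by (simp add: algebra_simps)
      then show ?thesis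
        using that(1) w2 by (auto simp: U_def vec_eq_iff forall_2)
    qed
    have cont_s: "continuous_on (\<phi> ` U) s"
      unfolding s_def by (intro continuous_intros) (use disc_nz in blast)
    have "continuous_on (\<phi> ` U) (\<lambda>f. if i = 1 then s f else f $ 3 - 3 * s f)" for i :: 2
      using cont_s by (cases "i = 1") (auto intro!: continuous_intros)
    then show "continuous_on (\<phi> ` U) (\<lambda>f. (\<chi> i. if i = 1 then s f else f $ 3 - 3 * s f) :: real ^ 2)"
      by (rule continuous_on_vec_lambda)
    show "(\<chi> i. if i = 1 then s (\<phi> u) else \<phi> u $ 3 - 3 * s (\<phi> u)) = u" if "u \<in> U" for u
      using s[OF that] by (simp add: vec_eq_iff forall_2 \<phi>_def)
    show "qform (\<phi> u) = 0" for u
      by (simp add: qform_def \<phi>_def power2_eq_square power3_eq_cube field_simps)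
  qed (use poly proj_orbit_subset_Ein[OF null] in \<open>auto simp: \<phi>_def\<close>)
  moreover have "lifted_tangent_space \<phi> u0 = {mk_quartic x y z 0 0 |x y z. True}"
  proof (intro equalityI subsetI)
    fix v assume "v \<in> {mk_quartic x y z 0 0 |x y z. True}"
    then obtain x y z where "v = mk_quartic x y z 0 0"
      by blast
    \<comment> \<open>Solution of 3 w_1 = z and x + 3 w_1 + w_2 = y.\<close>
    then have "v = x *\<^sub>R \<phi> u0 + frechet_derivative \<phi> (at u0) (vector [z / 3, y - x - z])"
      by (simp add: quartic_eq_iff at_u0)
    then show "v \<in> lifted_tangent_space \<phi> u0"
      unfolding lifted_tangent_space_def by blast
  next
    fix v assume "v \<in> lifted_tangent_space \<phi> u0"
    then obtain c and w :: "real ^ 2" where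
      "v = c *\<^sub>R mk_quartic 1 1 0 0 0 + mk_quartic 0 (3 * w $ 1 + w $ 2) (3 * w $ 1) 0 0"
      unfolding lifted_tangent_space_def at_u0 by blast
    then have "v = mk_quartic c (c + (3 * w $ 1 + w $ 2)) (3 * w $ 1) 0 0"
      by (simp add: quartic_eq_iff)
    then show "v \<in> {mk_quartic x y z 0 0 |x y z. True}"
      by blast
  qed
  moreover have "u0 \<in> U"
    by (simp add: u0_def U_def)
  ultimately show ?thesis
    using tangent_signature_X3Y at_u0(1) by (intro immersed_proj_orbit[OF null poly, of U u0]) auto
qed

lemma immersed_orbit_X4XY3:
  "immersed_submanifold_with_signature TYPE(real ^ 3) (proj_orbit X4XY3) (1, 2, 0)"
proof -
  \<comment> \<open>For a_4 = 1 the null equation is solved for a_0, so the chart is a graph over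
    (a_3, a_2, a_1).\<close>
  define \<phi> :: "real ^ 3 \<Rightarrow> quartic" where
    "\<phi> = (\<lambda>u. mk_quartic 1 (u $ 1) (u $ 2) (u $ 3) (1 / 4 * (u $ 1 * u $ 3) - 1 / 12 * (u $ 2)\<^sup>2))"
  define U :: "(real ^ 3) set" where "U = {u. catalecticant (\<phi> u) \<noteq> 0}"
  define u0 :: "real ^ 3" where "u0 = vector [0, 0, 1]"
  have null: "X4XY3 \<noteq> 0" "qform X4XY3 = 0"
    by (auto simp: quartic_eq_iff qform_def)
  have poly: "polynomial_function \<phi>"
    unfolding \<phi>_def by (intro polynomial_function_mk_quartic real_polynomial_function_diff
        real_polynomial_function.intros(2-4) real_polynomial_function_power real_polynomial_function_nth)
  have deriv: "frechet_derivative \<phi> (at u) = (\<lambda>w. mk_quartic 0 (w $ 1) (w $ 2) (w $ 3)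
      (1 / 4 * (u $ 1 * w $ 3 + w $ 1 * u $ 3) - 1 / 6 * u $ 2 * w $ 2))" for u
    unfolding \<phi>_def
    by (rule frechet_derivative_at[symmetric], rule has_derivative_mk_quartic)
      (auto intro!: derivative_eq_intros simp: fun_eq_iff algebra_simps)
  have q: "qform (\<phi> u) = 0" for u
    by (simp add: qform_def \<phi>_def)
  have at_u0: "\<phi> u0 = X4XY3"
    "frechet_derivative \<phi> (at u0) = (\<lambda>w. mk_quartic 0 (w $ 1) (w $ 2) (w $ 3) (w $ 1 / 4))"
    unfolding deriv by (simp_all add: \<phi>_def u0_def)
  have "local_param (subtopology Ein_topology (proj_orbit X4XY3)) U \<phi>"
  proof (rule local_param_affine[where h = "\<lambda>f. \<chi> i. if i = 1 then f $ 3 else if i = 2 then f $ 2 else f $ 1"])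
    have "continuous_on UNIV (\<lambda>u. catalecticant (\<phi> u))"
      unfolding catalecticant_def
      by (intro continuous_intros continuous_on_polymonial_function poly) auto
    then show "open U"
      unfolding U_def by (intro open_Collect_neq) auto
    show "(proj_point \<circ> \<phi>) ` U = proj_orbit X4XY3 \<inter> affine_part"
    proof (intro equalityI subsetI)
      fix p assume "p \<in> (proj_point \<circ> \<phi>) ` U"
      then obtain u where u: "u \<in> U" "p = proj_point (\<phi> u)"
        by auto
      moreover have "\<phi> u $ 4 = 1"
        by (simp add: \<phi>_def)
      moreover from this have "\<phi> u \<noteq> 0"
        by auto
      ultimately show "p \<in> proj_orbit X4XY3 \<inter> affine_part"
        using q by (auto simp: proj_orbit_X4XY3 U_def proj_point_in_affine_part)
    next
      fix p assume p: "p \<in> proj_orbit X4XY3 \<inter> affine_part"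
      then obtain f where f: "p = proj_point f" "f \<noteq> 0" "qform f = 0" "catalecticant f \<noteq> 0"
        by (auto simp: proj_orbit_X4XY3)
      then have f4: "f $ 4 \<noteq> 0"
        using p by (simp add: proj_point_in_affine_part)
      define u :: "real ^ 3" where "u = vector [f $ 3 / f $ 4, f $ 2 / f $ 4, f $ 1 / f $ 4]"
      have f0: "f $ 0 = (3 * (f $ 1 * f $ 3) - (f $ 2)\<^sup>2) / (12 * f $ 4)"
        using f(3) f4 by (simp add: qform_def field_simps)
      have "f $ 0 = f $ 4 * \<phi> u $ 0"
        unfolding f0 using f4 by (simp add: \<phi>_def u_def field_simps power2_eq_square)
      then have fu: "f = f $ 4 *\<^sub>R \<phi> u"
        using f4 by (simp add: quartic_eq_iff) (simp add: \<phi>_def u_def)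
      then have "p = proj_point (\<phi> u)"
        using f(1) f4 proj_point_scaleR by metis
      moreover have "catalecticant (\<phi> u) \<noteq> 0"
        using f(4) fu catalecticant_scaleR by (metis mult_zero_right)
      ultimately show "p \<in> (proj_point \<circ> \<phi>) ` U"
        by (auto simp: U_def)
    qed
    have "continuous_on (\<phi> ` U) (\<lambda>f. if i = 1 then f $ 3 else if i = 2 then f $ 2 else f $ 1)" for i :: 3
      by (cases "i = 1"; cases "i = 2") (auto intro!: continuous_intros)
    then show "continuous_on (\<phi> ` U)
        (\<lambda>f. (\<chi> i. if i = 1 then f $ 3 else if i = 2 then f $ 2 else f $ 1) :: real ^ 3)"
      by (rule continuous_on_vec_lambda)
    show "w = 0" if "frechet_derivative \<phi> (at u) w = 0" for u w
      using that by (simp add: deriv quartic_eq_iff vec_eq_iff forall_3)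
  qed (use poly q proj_orbit_subset_Ein[OF null] in \<open>auto simp: \<phi>_def vec_eq_iff forall_3\<close>)
  moreover have "lifted_tangent_space \<phi> u0 = {mk_quartic x y z w (y / 4) |x y z w. True}"
  proof (intro equalityI subsetI)
    fix v assume "v \<in> {mk_quartic x y z w (y / 4) |x y z w. True}"
    then obtain x y z w where "v = mk_quartic x y z w (y / 4)"
      by blast
    \<comment> \<open>The base point already contributes x to the X Y^3 coefficient, hence w -
      x.\<close>
    then have "v = x *\<^sub>R \<phi> u0 + frechet_derivative \<phi> (at u0) (vector [y, z, w - x])"
      by (simp add: quartic_eq_iff at_u0)
    then show "v \<in> lifted_tangent_space \<phi> u0"
      unfolding lifted_tangent_space_def by blast
  next
    fix v assume "v \<in> lifted_tangent_space \<phi> u0"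
    then obtain c and w :: "real ^ 3" where
      "v = c *\<^sub>R X4XY3 + mk_quartic 0 (w $ 1) (w $ 2) (w $ 3) (w $ 1 / 4)"
      unfolding lifted_tangent_space_def at_u0 by blast
    then have "v = mk_quartic c (w $ 1) (w $ 2) (c + w $ 3) (w $ 1 / 4)"
      by (simp add: quartic_eq_iff)
    then show "v \<in> {mk_quartic x y z w (y / 4) |x y z w. True}"
      by blast
  qed
  moreover have "u0 \<in> U"
    by (simp add: U_def at_u0 catalecticant_def)
  ultimately show ?thesis
    using tangent_signature_X4XY3 at_u0(1) by (intro immersed_proj_orbit[OF null poly, of U u0]) auto
qed

text \<open>Nonvanishing of a homogeneous polynomial does not depend on the representative, so it
  cuts out an open set of the whole projective space; the orbit is its trace on
  \<open>Ein\<close>.\<close>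

lemma openin_orbit_X4XY3: "openin Ein_topology (proj_orbit X4XY3)"
proof -
  define V where "V = {proj_point f |f. f \<noteq> 0 \<and> catalecticant f \<noteq> 0}"
  have V: "proj_point f \<in> V \<longleftrightarrow> catalecticant f \<noteq> 0" if "f \<noteq> 0" for f
  proof
    assume "proj_point f \<in> V"
    then obtain g where "proj_point f = proj_point g" "catalecticant g \<noteq> 0"
      by (auto simp: V_def)
    then show "catalecticant f \<noteq> 0"
      using that by (metis proj_point_eqD catalecticant_scaleR mult_eq_0_iff power_not_zero)
  qed (use that in \<open>auto simp: V_def\<close>)
  have "{f. f \<noteq> 0 \<and> proj_point f \<in> V} = {f. f \<noteq> 0} \<inter> {f. catalecticant f \<noteq> 0}"
    using V by blast
  moreover have "open {f. catalecticant f \<noteq> 0}"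
    unfolding catalecticant_def by (intro open_Collect_neq continuous_intros) auto
  moreover have "open {f :: quartic. f \<noteq> 0}"
    by (intro open_Collect_neq continuous_intros)
  ultimately have "openin proj_topology V"
    by (auto simp: openin_proj_topology V_def proj_space_def)
  moreover have "proj_orbit X4XY3 = V \<inter> Ein"
    unfolding proj_orbit_X4XY3 Ein_def using V by (auto simp: V_def)
  ultimately show ?thesis
    by (auto simp: Ein_topology_def openin_subtopology)
qed

theorem theorem1p1:
  shows "\<exists>O1 O2 O3.
    orbits PSL2 Ein PSL2_act = {O1, O2, O3} \<and> O1 \<noteq> O2 \<and> O1 \<noteq> O3 \<and> O2 \<noteq> O3 \<and>
    immersed_submanifold_with_signature TYPE(real ^ 1) O1 (0, 0, 1) \<and>
    immersed_submanifold_with_signature TYPE(real ^ 2) O2 (0, 1, 1) \<and>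
    openin Ein_topology O3 \<and>
    immersed_submanifold_with_signature TYPE(real ^ 3) O3 (1, 2, 0) \<and>
    (\<forall>p\<in>O3. stabilizer PSL2 PSL2_act p = {\<one>\<^bsub>PSL2\<^esub>})"
  by (intro exI[of _ "proj_orbit X4"] exI[of _ "proj_orbit X3Y"] exI[of _ "proj_orbit X4XY3"])
    (use orbits_PSL2 proj_orbits_distinct immersed_orbit_X4 immersed_orbit_X3Y immersed_orbit_X4XY3
      openin_orbit_X4XY3 stabilizer_open_orbit in auto)

end
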